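(* Let $z\in{}^\omega2$ and $n\in\omega$. Let $(A_a:a<n)$ be $\Sigma^1_1(z)$ subsets of ${}^\omega2$ such that $\bigcap_{a<n}[A_a\cap H_z]_{E_0}\neq\emptyset$. Then there are $E_0$-trees $(p_a:a<n)$ such that for all $a,b<n$, $k\in\omega$ and $i<2$: (i) $|s^{p_a}|=|s^{p_b}|$ and $v_k^{i,p_a}=v_k^{i,p_b}$; (ii) $[p_a]\subseteq A_a$.
   Context: $E_0$ on ${}^\omega2$: $x\,E_0\,y$ iff $(\exists n)(\forall k>n)(x(k)=y(k))$; $[A]_{E_0}$ is the $E_0$-saturation of $A$. For $z\in{}^\omega2$, $S_z$ is the union of all $\Delta^1_1(z)$ sets $C\subseteq{}^\omega2$ whose distinct elements are pairwise $E_0$-inequivalent, and $H_z={}^\omega2\setminus S_z$. An $E_0$-tree is a tree $p\subseteq{}^{<\omega}2$ for which there are strings $s^p, v_k^{i,p}$ ($k\in\omega$, $i\in2$) with $\langle i\rangle\subseteq v_k^{i,p}$ and $|v_k^{0,p}|=|v_k^{1,p}|$, such that $p$ is the downward closure of $\{\varphi(\sigma):\sigma\in{}^{<\omega}2\}$, where $\varphi(\emptyset)=s^p$ and $\varphi(\sigma)=s^{p\frown}v_0^{\sigma(0),p\frown}\cdots{}^\frown v_{|\sigma|-1}^{\sigma(|\sigma|-1),p}$. $[p]$ is the set of branches of $p$. *)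

theory Defs
  imports Main "HOL-Library.Sublist"
begin

text \<open>
  Cantor space is \<open>nat \<Rightarrow> bool\<close>, with \<open>False\<close> for 0 and \<open>True\<close> for 1; finite binary strings are
  \<open>bool list\<close>.

  The lightface classes are defined by definability over the two-sorted structure of second-order
  arithmetic \<open>(\<omega>, \<omega>\<^sup>\<omega>, ap, +, *, exp, <, 0, 1)\<close>: a set is \<open>\<Sigma>\<^sup>1\<^sub>1(z)\<close> if it is defined by a formula
  \<open>\<exists>w \<in> \<omega>\<^sup>\<omega>. \<phi>(x, z, w)\<close> with \<open>\<phi>\<close> arithmetical, i.e. with quantifiers over \<open>\<omega>\<close> only. The function
  symbols of \<open>\<phi>\<close> denote the point \<open>x\<close>, the parameter \<open>z\<close> and the witness \<open>w\<close>.
\<close>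

datatype fsym = Point | Param | Witness

datatype aterm =
    Var nat
  | Zero
  | One
  | Plus aterm aterm
  | Times aterm aterm
  | Power aterm aterm
  | Ap fsym aterm

datatype aform =
    Equal aterm aterm
  | Less aterm aterm
  | Neg aform
  | Conj aform aform
  | Exists nat aform

primrec tm_val :: "(fsym \<Rightarrow> nat \<Rightarrow> nat) \<Rightarrow> (nat \<Rightarrow> nat) \<Rightarrow> aterm \<Rightarrow> nat" where
  "tm_val F e (Var j) = e j"
| "tm_val F e Zero = 0"
| "tm_val F e One = 1"
| "tm_val F e (Plus t u) = tm_val F e t + tm_val F e u"
| "tm_val F e (Times t u) = tm_val F e t * tm_val F e u"
| "tm_val F e (Power t u) = tm_val F e t ^ tm_val F e u"
| "tm_val F e (Ap f t) = F f (tm_val F e t)"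

primrec holds :: "(fsym \<Rightarrow> nat \<Rightarrow> nat) \<Rightarrow> (nat \<Rightarrow> nat) \<Rightarrow> aform \<Rightarrow> bool" where
  "holds F e (Equal t u) \<longleftrightarrow> tm_val F e t = tm_val F e u"
| "holds F e (Less t u) \<longleftrightarrow> tm_val F e t < tm_val F e u"
| "holds F e (Neg \<phi>) \<longleftrightarrow> \<not> holds F e \<phi>"
| "holds F e (Conj \<phi> \<psi>) \<longleftrightarrow> holds F e \<phi> \<and> holds F e \<psi>"
| "holds F e (Exists j \<phi>) \<longleftrightarrow> (\<exists>m. holds F (e(j := m)) \<phi>)"

primrec interp :: "(nat \<Rightarrow> bool) \<Rightarrow> (nat \<Rightarrow> bool) \<Rightarrow> (nat \<Rightarrow> nat) \<Rightarrow> fsym \<Rightarrow> nat \<Rightarrow> nat" where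
  "interp x z w Point = (\<lambda>k. of_bool (x k))"
| "interp x z w Param = (\<lambda>k. of_bool (z k))"
| "interp x z w Witness = w"

text \<open>
  The constant assignment makes formulas with free number variables harmless: such a variable
  behaves like the closed term 0.
\<close>

definition Sigma11 :: "(nat \<Rightarrow> bool) \<Rightarrow> (nat \<Rightarrow> bool) set \<Rightarrow> bool" where
  "Sigma11 z A \<longleftrightarrow> (\<exists>\<phi>. A = {x. \<exists>w. holds (interp x z w) (\<lambda>_. 0) \<phi>})"

definition Delta11 :: "(nat \<Rightarrow> bool) \<Rightarrow> (nat \<Rightarrow> bool) set \<Rightarrow> bool" where
  "Delta11 z A \<longleftrightarrow> Sigma11 z A \<and> Sigma11 z (- A)"

definition E0 :: "(nat \<Rightarrow> bool) \<Rightarrow> (nat \<Rightarrow> bool) \<Rightarrow> bool" where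
  "E0 x y \<longleftrightarrow> (\<exists>n. \<forall>k>n. x k = y k)"

definition E0_saturation :: "(nat \<Rightarrow> bool) set \<Rightarrow> (nat \<Rightarrow> bool) set" where
  "E0_saturation A = {y. \<exists>x\<in>A. E0 x y}"

definition S_set :: "(nat \<Rightarrow> bool) \<Rightarrow> (nat \<Rightarrow> bool) set" where
  "S_set z = \<Union> {C. Delta11 z C \<and> pairwise (\<lambda>x y. \<not> E0 x y) C}"

definition H_set :: "(nat \<Rightarrow> bool) \<Rightarrow> (nat \<Rightarrow> bool) set" where
  "H_set z = UNIV - S_set z"

definition E0_node :: "bool list \<Rightarrow> (nat \<Rightarrow> bool \<Rightarrow> bool list) \<Rightarrow> bool list \<Rightarrow> bool list" where
  "E0_node s v \<sigma> = s @ concat (map (\<lambda>k. v k (\<sigma> ! k)) [0..<length \<sigma>])"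

text \<open>
  \<open>E0_tree p s v\<close>: \<open>p\<close> is an \<open>E\<^sub>0\<close>-tree with \<open>s\<^sup>p = s\<close> and \<open>v\<^sub>k\<^sup>i\<^sup>,\<^sup>p = v k i\<close>. The strings are determined
  by \<open>p\<close>, since the nodes \<open>E0_node s v \<sigma>\<close> are exactly the splitting nodes of \<open>p\<close>.
\<close>

definition E0_tree :: "bool list set \<Rightarrow> bool list \<Rightarrow> (nat \<Rightarrow> bool \<Rightarrow> bool list) \<Rightarrow> bool" where
  "E0_tree p s v \<longleftrightarrow>
     (\<forall>k i. prefix [i] (v k i)) \<and>
     (\<forall>k. length (v k False) = length (v k True)) \<and>
     p = {t. \<exists>\<sigma>. prefix t (E0_node s v \<sigma>)}"

definition branches :: "bool list set \<Rightarrow> (nat \<Rightarrow> bool) set" where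
  "branches p = {x. \<forall>m. map x [0..<m] \<in> p}"

end

theory Submission
  imports Defs "HOL-Library.Nat_Bijection"
begin

text \<open>
  Since \<open>E\<^sub>0\<close>-equivalent points differ on a finite stem only, the case of \<open>n\<close> sets reduces to one
  \<open>\<Sigma>\<^sup>1\<^sub>1(z)\<close> set \<open>A\<close> that meets \<open>H\<^sub>z\<close>: replace the \<open>A\<^sub>a\<close> by the set of all points whose tail lands in
  every \<open>A\<^sub>a\<close> after the appropriate stem has been grafted onto it, find an \<open>E\<^sub>0\<close>-tree there, and
  exchange its stem.

  Write \<open>A\<close> as the projection of a tree \<open>T\<close>. A node is a finite family of equally long elements of
  \<open>T\<close>; a child of a node is obtained by extending all members along two strings that split, which
  doubles the family. An infinite chain of children yields an \<open>E\<^sub>0\<close>-tree inside \<open>A\<close>. If there is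
  none, the child relation is well-founded, and every point of \<open>A\<close> lies in a \<open>\<Delta>\<^sup>1\<^sub>1(z)\<close> set of pairwise
  inequivalent points, so that \<open>A\<close> misses \<open>H\<^sub>z\<close>. Indeed, for a point \<open>y\<close> consider the tree of attempts to extend
  the members of a node by the tail of \<open>y\<close> to branches. A node selects the member of an \<open>E\<^sub>0\<close>-class
  whose tree has strictly the largest rank. Two different members with has_chain-founded trees would
  give a child with an has_chain-founded tree; hence at a node whose descendants select nothing at most
  one rank is infinite, the comparison of ranks is \<open>\<Delta>\<^sup>1\<^sub>1\<close>, and if some member realizes the node, then
  it is selected. The recursion along the well-founded child relation that decides whether
  something is selected below a node has a unique solution, so it is \<open>\<Delta>\<^sup>1\<^sub>1\<close> as well. Neither a universal
  \<open>\<Sigma>\<^sup>1\<^sub>1\<close> set nor an ordinal is needed: ranks are compared by simulations.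
\<close>

subsection \<open>Quantifier-free predicates\<close>

text \<open>A shallow embedding of terms and, below, of quantifier-free formulas: \<open>G\<close>
  interprets the function symbols and \<open>e\<close> the number variables. The symbol types stay
  arbitrary so that fresh symbols can be adjoined through sums and \<open>option\<close>.\<close>

inductive qterm :: "(('f \<Rightarrow> nat \<Rightarrow> nat) \<Rightarrow> ('v \<Rightarrow> nat) \<Rightarrow> nat) \<Rightarrow> bool" where
  qterm_var: "qterm (\<lambda>G e. e v)"
| qterm_zero: "qterm (\<lambda>G e. 0)"
| qterm_one: "qterm (\<lambda>G e. 1)"
| qterm_plus: "qterm t \<Longrightarrow> qterm u \<Longrightarrow> qterm (\<lambda>G e. t G e + u G e)"
| qterm_times: "qterm t \<Longrightarrow> qterm u \<Longrightarrow> qterm (\<lambda>G e. t G e * u G e)"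
| qterm_power: "qterm t \<Longrightarrow> qterm u \<Longrightarrow> qterm (\<lambda>G e. t G e ^ u G e)"
| qterm_app: "qterm t \<Longrightarrow> qterm (\<lambda>G e. G f (t G e))"

inductive qfree :: "(('f \<Rightarrow> nat \<Rightarrow> nat) \<Rightarrow> ('v \<Rightarrow> nat) \<Rightarrow> bool) \<Rightarrow> bool" where
  qfree_eq: "qterm t \<Longrightarrow> qterm u \<Longrightarrow> qfree (\<lambda>G e. t G e = u G e)"
| qfree_less: "qterm t \<Longrightarrow> qterm u \<Longrightarrow> qfree (\<lambda>G e. t G e < u G e)"
| qfree_neg: "qfree P \<Longrightarrow> qfree (\<lambda>G e. \<not> P G e)"
| qfree_conj: "qfree P \<Longrightarrow> qfree Q \<Longrightarrow> qfree (\<lambda>G e. P G e \<and> Q G e)"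

lemma qterm_const: "qterm (\<lambda>G e. n)"
proof (induction n)
  case (Suc n)
  from qterm_plus[OF this qterm_one] show ?case by (simp only: Suc_eq_plus1)
qed (rule qterm_zero)

lemma qfree_disj:
  assumes "qfree P" "qfree Q" shows "qfree (\<lambda>G e. P G e \<or> Q G e)"
  using qfree_neg[OF qfree_conj[OF qfree_neg[OF assms(1)] qfree_neg[OF assms(2)]]] by simp

lemma qfree_imp:
  assumes "qfree P" "qfree Q" shows "qfree (\<lambda>G e. P G e \<longrightarrow> Q G e)"
  unfolding imp_conv_disj by (rule qfree_disj[OF qfree_neg[OF assms(1)] assms(2)])

text \<open>A function symbol may be replaced by an operation that also reads variables, not merely
  by another symbol. This is what later allows a whole family of functions to be stored in a single
  one by pairing its index with the argument.\<close>

lemma qterm_subst: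
  assumes "qterm t"
    and "\<And>f u. qterm u \<Longrightarrow> qterm (\<lambda>G e. F f G e (u G e))" and "\<And>v. qterm (V v)"
  shows "qterm (\<lambda>G e. t (\<lambda>f. F f G e) (\<lambda>v. V v G e))"
  using assms(1) by induction (auto intro: qterm.intros qterm_const assms(2,3))

lemma qfree_subst:
  assumes "qfree P"
    and "\<And>f u. qterm u \<Longrightarrow> qterm (\<lambda>G e. F f G e (u G e))" and "\<And>v. qterm (V v)"
  shows "qfree (\<lambda>G e. P (\<lambda>f. F f G e) (\<lambda>v. V v G e))"
  using assms(1) by induction (auto intro: qfree.intros qterm_subst[OF _ assms(2,3)])

section \<open>Moduli of continuity\<close>

definition modulus ::
    "(nat \<Rightarrow> ('f \<Rightarrow> nat \<Rightarrow> nat) \<Rightarrow> ('v \<Rightarrow> nat) \<Rightarrow> bool) \<Rightarrow> (('f \<Rightarrow> nat \<Rightarrow> nat) \<Rightarrow> ('v \<Rightarrow> nat) \<Rightarrow> 'r) \<Rightarrow> bool"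
where
  \<comment> \<open>\<open>B m\<close> says that the evaluation of \<open>t\<close> only queries the functions below \<open>m\<close>.\<close>
  "modulus B t \<longleftrightarrow>
    qfree (\<lambda>G e. B (e None) G (\<lambda>v. e (Some v))) \<and>
    (\<forall>m m' G e. m \<le> m' \<longrightarrow> B m G e \<longrightarrow> B m' G e) \<and>
    (\<forall>m G G' e. B m G e \<longrightarrow> (\<forall>f x. x < m \<longrightarrow> G f x = G' f x) \<longrightarrow> B m G' e \<and> t G' e = t G e) \<and>
    (\<forall>G e. \<exists>m. B m G e)"

lemma qfree_True: "qfree (\<lambda>G e. True)"
  using qfree_eq[OF qterm_zero qterm_zero] by simp

lemma modulusI:
  assumes "qfree (\<lambda>G e. B (e None) G (\<lambda>v. e (Some v)))"
    and "\<And>m m' G e. m \<le> m' \<Longrightarrow> B m G e \<Longrightarrow> B m' G e"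
    and "\<And>m G G' e. B m G e \<Longrightarrow> (\<And>f x. x < m \<Longrightarrow> G f x = G' f x) \<Longrightarrow> B m G' e \<and> t G' e = t G e"
    and "\<And>G e. \<exists>m. B m G e"
  shows "modulus B t"
  unfolding modulus_def
proof (intro conjI allI impI)
  show "qfree (\<lambda>G e. B (e None) G (\<lambda>v. e (Some v)))" by (rule assms(1))
  show "B m' G e" if "m \<le> m'" "B m G e" for m m' G e by (rule assms(2)[OF that])
  show "B m G' e" "t G' e = t G e" if "B m G e" "\<forall>f x. x < m \<longrightarrow> G f x = G' f x" for m G G' e
    using assms(3)[OF that(1), of G'] that(2) by simp_all
  show "\<exists>m. B m G e" for G e by (rule assms(4))
qed

lemma
  assumes "modulus B t"
  shows modulus_qfree: "qfree (\<lambda>G e. B (e None) G (\<lambda>v. e (Some v)))"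
    and modulus_mono: "m \<le> m' \<Longrightarrow> B m G e \<Longrightarrow> B m' G e"
    and modulus_ex: "\<exists>m. B m G e"
  using assms unfolding modulus_def by simp_all

lemma modulus_agree:
  assumes "modulus B t" "B m G e" "\<And>f x. x < m \<Longrightarrow> G f x = G' f x"
  shows "B m G' e \<and> t G' e = t G e"
proof -
  have "\<forall>m G G' e. B m G e \<longrightarrow> (\<forall>f x. x < m \<longrightarrow> G f x = G' f x) \<longrightarrow> B m G' e \<and> t G' e = t G e"
    using assms(1) unfolding modulus_def by (elim conjE)
  from this[rule_format, OF assms(2,3)] show ?thesis .
qed

lemma modulus_const: "modulus (\<lambda>_ _ _. True) (\<lambda>G e. t e)"
  by (rule modulusI) (simp_all add: qfree_True)

lemma modulus_binary:
  assumes B: "modulus B t" and C: "modulus C u"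
  shows "modulus (\<lambda>m G e. B m G e \<and> C m G e) (\<lambda>G e. f (t G e) (u G e))"
proof (rule modulusI)
  show "\<exists>m. B m G e \<and> C m G e" for G e
  proof -
    obtain m m' where "B m G e" "C m' G e" using modulus_ex[OF B] modulus_ex[OF C] by metis
    then have "B (max m m') G e \<and> C (max m m') G e"
      using modulus_mono[OF B, of m "max m m'"] modulus_mono[OF C, of m' "max m m'"] by simp
    then show ?thesis by (rule exI)
  qed
  show "(B m G' e \<and> C m G' e) \<and> f (t G' e) (u G' e) = f (t G e) (u G e)"
    if "B m G e \<and> C m G e" "\<And>f x. x < m \<Longrightarrow> G f x = G' f x" for m G G' e
    using modulus_agree[OF B, of m G e G'] modulus_agree[OF C, of m G e G'] that by simp
  show "B m' G e \<and> C m' G e" if "m \<le> m'" "B m G e \<and> C m G e" for m m' G e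
    using modulus_mono[OF B that(1)] modulus_mono[OF C that(1)] that(2) by simp
  show "qfree (\<lambda>G e. B (e None) G (\<lambda>v. e (Some v)) \<and> C (e None) G (\<lambda>v. e (Some v)))"
    by (rule qfree_conj[OF modulus_qfree[OF B] modulus_qfree[OF C]])
qed

text \<open>If the inner term only queries below \<open>m\<close>, it has the same value under every
  \<open>G'\<close> agreeing with \<open>G\<close> there, so the outer query is made at the same
  place; requiring that place to lie below \<open>m\<close> makes the answers agree.\<close>

lemma modulus_app:
  assumes B: "modulus B t" and t: "qterm t"
  shows "modulus (\<lambda>m G e. B m G e \<and> t G e < m) (\<lambda>G e. G f (t G e))"
proof (rule modulusI)
  show "\<exists>m. B m G e \<and> t G e < m" for G e
  proof -
    obtain m where "B m G e" using modulus_ex[OF B] by metis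
    then have "B (m + Suc (t G e)) G e" by (rule modulus_mono[OF B, rotated]) simp
    then show ?thesis by (intro exI[of _ "m + Suc (t G e)"]) simp
  qed
  show "(B m G' e \<and> t G' e < m) \<and> G' f (t G' e) = G f (t G e)"
    if "B m G e \<and> t G e < m" "\<And>f x. x < m \<Longrightarrow> G f x = G' f x" for m G G' e
    using modulus_agree[OF B, of m G e G'] that by simp
  show "B m' G e \<and> t G e < m'" if "m \<le> m'" "B m G e \<and> t G e < m" for m m' G e
    using modulus_mono[OF B that(1)] that by simp
  have "qterm (\<lambda>G e. t G (\<lambda>v. e (Some v)))"
    by (rule qterm_subst[OF t, where F = "\<lambda>f G e. G f" and V = "\<lambda>v G e. e (Some v)"])
      (rule qterm_app qterm_var, assumption?)+
  then show "qfree (\<lambda>G e. B (e None) G (\<lambda>v. e (Some v)) \<and> t G (\<lambda>v. e (Some v)) < e None)"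
    by (rule qfree_conj[OF modulus_qfree[OF B] qfree_less[OF _ qterm_var]])
qed

lemma qterm_modulus: "qterm t \<Longrightarrow> \<exists>B. modulus B t"
proof (induction rule: qterm.induct)
  case (qterm_var v)
  show ?case by (rule exI) (rule modulus_const)
next
  case qterm_zero
  show ?case by (rule exI) (rule modulus_const)
next
  case qterm_one
  show ?case by (rule exI) (rule modulus_const)
next
  case (qterm_plus t u)
  show ?case by (rule exE[OF qterm_plus(3)], rule exE[OF qterm_plus(4)], rule exI)
      (rule modulus_binary[of _ _ _ _ "(+)"])
next
  case (qterm_times t u)
  show ?case by (rule exE[OF qterm_times(3)], rule exE[OF qterm_times(4)], rule exI)
      (rule modulus_binary[of _ _ _ _ "(*)"])
next
  case (qterm_power t u)
  show ?case by (rule exE[OF qterm_power(3)], rule exE[OF qterm_power(4)], rule exI)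
      (rule modulus_binary[of _ _ _ _ "(^)"])
next
  case (qterm_app t f)
  show ?case by (rule exE[OF qterm_app(2)], rule exI) (rule modulus_app[OF _ qterm_app(1)])
qed

text \<open>Since the bound on the queries is itself quantifier-free, a matrix can be truncated at
  stage \<open>m\<close> inside the language; \<open>Sigma11_tree\<close> uses this to turn the
  matrix into a tree.\<close>

lemma qfree_modulus: "qfree Q \<Longrightarrow> \<exists>B. modulus B Q"
proof (induction rule: qfree.induct)
  case (qfree_eq t u)
  show ?case by (rule exE[OF qterm_modulus[OF qfree_eq(1)]], rule exE[OF qterm_modulus[OF qfree_eq(2)]],
        rule exI) (rule modulus_binary[of _ _ _ _ "(=)"])
next
  case (qfree_less t u)
  show ?case by (rule exE[OF qterm_modulus[OF qfree_less(1)]], rule exE[OF qterm_modulus[OF qfree_less(2)]],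
        rule exI) (rule modulus_binary[of _ _ _ _ "(<)"])
next
  case (qfree_neg P)
  show ?case by (rule exE[OF qfree_neg(2)], rule exI)
      (rule modulus_binary[of _ _ _ _ "\<lambda>p q. \<not> p"])
next
  case (qfree_conj P Q)
  show ?case by (rule exE[OF qfree_conj(3)], rule exE[OF qfree_conj(4)], rule exI)
      (rule modulus_binary[of _ _ _ _ "(\<and>)"])
qed

text \<open>Twice Cantor's pairing function: without the division by two it is a term of the language.\<close>

definition pairing :: "nat \<Rightarrow> nat \<Rightarrow> nat" where
  "pairing a b = (a + b) * (a + b + 1) + 2 * a"

lemma pairing_conv: "pairing a b = 2 * prod_encode (a, b)"
proof -
  have "2 * triangle n = n * Suc n" for n by (induction n) simp_all
  then show ?thesis by (simp add: pairing_def prod_encode_def distrib_left)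
qed

lemma prod_decode_pairing [simp]: "prod_decode (pairing a b div 2) = (a, b)"
  by (simp add: pairing_conv)

lemma pairing_eq_iff [simp]: "pairing a b = pairing c d \<longleftrightarrow> a = c \<and> b = d"
  by (simp add: pairing_conv)

lemma pairing_mono: "a \<le> a' \<Longrightarrow> b \<le> b' \<Longrightarrow> pairing a b \<le> pairing a' b'"
  unfolding pairing_def by (intro add_mono mult_le_mono) auto

lemma qterm_pairing:
  assumes "qterm t" "qterm u" shows "qterm (\<lambda>G e. pairing (t G e) (u G e))"
  unfolding pairing_def by (intro qterm.intros assms qterm_const)

subsection \<open>Definable predicates\<close>

text \<open>The normal form of a \<open>\<Sigma>\<^sup>1\<^sub>1\<close> predicate.
  \<open>Inl\<close> marks free symbols and \<open>Inr\<close> bound ones. \<open>H\<close> and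
  \<open>k\<close> are infinite sequences of functions and numbers, but a quantifier-free
  \<open>Q\<close> mentions only finitely many of them.\<close>

definition ex_all ::
    "((nat + nat \<Rightarrow> nat \<Rightarrow> nat) \<Rightarrow> (nat + nat \<Rightarrow> nat) \<Rightarrow> bool) \<Rightarrow> (nat \<Rightarrow> nat \<Rightarrow> nat) \<Rightarrow> (nat \<Rightarrow> nat) \<Rightarrow> bool"
where
  "ex_all Q G e \<longleftrightarrow> (\<exists>H. \<forall>k. Q (case_sum G H) (case_sum e k))"

definition Sigma_pred :: "((nat \<Rightarrow> nat \<Rightarrow> nat) \<Rightarrow> (nat \<Rightarrow> nat) \<Rightarrow> bool) \<Rightarrow> bool" where
  "Sigma_pred P \<longleftrightarrow> (\<exists>Q. qfree Q \<and> (\<forall>G e. P G e \<longleftrightarrow> ex_all Q G e))"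

lemma Sigma_predI:
  assumes "qfree Q" "\<And>G e. P G e \<longleftrightarrow> ex_all Q G e"
  shows "Sigma_pred P"
  using assms unfolding Sigma_pred_def by blast

lemma Sigma_predE:
  assumes "Sigma_pred P"
  obtains Q where "qfree Q" "\<And>G e. P G e \<longleftrightarrow> ex_all Q G e"
  using assms unfolding Sigma_pred_def by blast

lemma Sigma_pred_qfree: assumes "qfree P" shows "Sigma_pred P"
proof (rule Sigma_predI)
  show "qfree (\<lambda>G e. P (\<lambda>f. G (Inl f)) (\<lambda>v. e (Inl v)))"
    by (rule qfree_subst[OF assms]) (auto intro: qterm.intros)
qed (simp add: ex_all_def)

lemma qfree_reindex:
  fixes P :: "('f \<Rightarrow> nat \<Rightarrow> nat) \<Rightarrow> ('v \<Rightarrow> nat) \<Rightarrow> bool"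
    and V :: "'v \<Rightarrow> ('g \<Rightarrow> nat \<Rightarrow> nat) \<Rightarrow> ('w \<Rightarrow> nat) \<Rightarrow> nat"
  assumes "qfree P" and "\<And>v. qterm (V v)"
  shows "qfree (\<lambda>G e. P (\<lambda>f. G (\<pi> f)) (\<lambda>v. V v G e))"
  by (rule qfree_subst[OF assms(1), of "\<lambda>f G e. G (\<pi> f)" V]) (auto intro: qterm_app assms(2))

lemma Sigma_pred_subst:
  assumes "Sigma_pred P" and V: "\<And>v. qterm (V v)"
  shows "Sigma_pred (\<lambda>G e. P (\<lambda>f. G (\<pi> f)) (\<lambda>v. V v G e))"
proof -
  obtain Q where Q: "qfree Q" "\<And>G e. P G e \<longleftrightarrow> ex_all Q G e"
    by (rule Sigma_predE[OF assms(1)], rule that)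
  define W where "W v G e = (case v of Inl i \<Rightarrow> V i (\<lambda>f. G (Inl f)) (\<lambda>v. e (Inl v)) | Inr i \<Rightarrow> e (Inr i))"
    for v :: "nat + nat" and G :: "nat + nat \<Rightarrow> nat \<Rightarrow> nat" and e :: "nat + nat \<Rightarrow> nat"
  have W: "qterm (W v)" for v
    unfolding W_def[abs_def]
    by (cases v) (auto intro: qterm.intros
        qterm_subst[OF V, of "\<lambda>f G e. G (Inl f)" "\<lambda>v G e. e (Inl v)"])
  show ?thesis
  proof (rule Sigma_predI)
    show "qfree (\<lambda>G e. Q (\<lambda>f. G (map_sum \<pi> id f)) (\<lambda>v. W v G e))"
      by (rule qfree_reindex[OF Q(1) W])
    fix G :: "nat \<Rightarrow> nat \<Rightarrow> nat" and e :: "nat \<Rightarrow> nat"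
    have "(\<lambda>f. case_sum G H (map_sum \<pi> id f)) = case_sum (\<lambda>f. G (\<pi> f)) H"
      and "(\<lambda>v. W v (case_sum G H) (case_sum e k)) = case_sum (\<lambda>v. V v G e) k" for H k
      by (auto simp: fun_eq_iff W_def split: sum.split)
    then show "P (\<lambda>f. G (\<pi> f)) (\<lambda>v. V v G e) \<longleftrightarrow>
        ex_all (\<lambda>G e. Q (\<lambda>f. G (map_sum \<pi> id f)) (\<lambda>v. W v G e)) G e"
      by (simp add: Q(2) ex_all_def)
  qed
qed

text \<open>The witnesses of the two conjuncts are interleaved on even and odd indices, while the
  universally quantified tuple is shared.\<close>

lemma Sigma_pred_conj:
  assumes "Sigma_pred P" "Sigma_pred P'"
  shows "Sigma_pred (\<lambda>G e. P G e \<and> P' G e)"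
proof -
  obtain Q where Q: "qfree Q" "\<And>G e. P G e \<longleftrightarrow> ex_all Q G e"
    by (rule Sigma_predE[OF assms(1)], rule that)
  obtain Q' where Q': "qfree Q'" "\<And>G e. P' G e \<longleftrightarrow> ex_all Q' G e"
    by (rule Sigma_predE[OF assms(2)], rule that)
  show ?thesis
  proof (rule Sigma_predI)
    show "qfree (\<lambda>G e. Q (\<lambda>f. G (map_sum id (\<lambda>i. 2 * i) f)) (\<lambda>v. e v) \<and>
        Q' (\<lambda>f. G (map_sum id (\<lambda>i. 2 * i + 1) f)) (\<lambda>v. e v))" (is "qfree ?R")
      by (rule qfree_conj[OF qfree_reindex[OF Q(1) qterm_var] qfree_reindex[OF Q'(1) qterm_var]])
    fix G :: "nat \<Rightarrow> nat \<Rightarrow> nat" and e :: "nat \<Rightarrow> nat"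
    have *: "(\<lambda>f. case_sum G H (map_sum id \<rho> f)) = case_sum G (\<lambda>i. H (\<rho> i))" for H and \<rho> :: "nat \<Rightarrow> nat"
      by (auto simp: fun_eq_iff split: sum.split)
    show "P G e \<and> P' G e \<longleftrightarrow> ex_all ?R G e"
      unfolding ex_all_def
    proof
      assume "P G e \<and> P' G e"
      then obtain H H' where "\<forall>k. Q (case_sum G H) (case_sum e k)" "\<forall>k. Q' (case_sum G H') (case_sum e k)"
        by (auto simp: Q(2) Q'(2) ex_all_def)
      then have "\<forall>k. ?R (case_sum G (\<lambda>i. if even i then H (i div 2) else H' (i div 2))) (case_sum e k)"
        by (simp add: *)
      then show "\<exists>H. \<forall>k. ?R (case_sum G H) (case_sum e k)" by blast
    next
      assume "\<exists>H. \<forall>k. ?R (case_sum G H) (case_sum e k)"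
      then show "P G e \<and> P' G e"
        unfolding * Q(2) Q'(2) ex_all_def by blast
    qed
  qed
qed

text \<open>A fresh function in front of the witnesses announces by its value at 0 which disjunct is
  being witnessed.\<close>

lemma Sigma_pred_disj:
  assumes "Sigma_pred P" "Sigma_pred P'"
  shows "Sigma_pred (\<lambda>G e. P G e \<or> P' G e)"
proof -
  obtain Q where Q: "qfree Q" "\<And>G e. P G e \<longleftrightarrow> ex_all Q G e"
    by (rule Sigma_predE[OF assms(1)], rule that)
  obtain Q' where Q': "qfree Q'" "\<And>G e. P' G e \<longleftrightarrow> ex_all Q' G e"
    by (rule Sigma_predE[OF assms(2)], rule that)
  show ?thesis
  proof (rule Sigma_predI)
    have z: "qfree (\<lambda>G e. G (Inr 0) 0 = 0)" by (rule qfree_eq[OF qterm_app[OF qterm_zero] qterm_zero])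
    show "qfree (\<lambda>G e. G (Inr 0) 0 = 0 \<and> Q (\<lambda>f. G (map_sum id Suc f)) (\<lambda>v. e v) \<or>
        \<not> G (Inr 0) 0 = 0 \<and> Q' (\<lambda>f. G (map_sum id Suc f)) (\<lambda>v. e v))" (is "qfree ?R")
      by (rule qfree_disj[OF qfree_conj[OF z qfree_reindex[OF Q(1) qterm_var]]
            qfree_conj[OF qfree_neg[OF z] qfree_reindex[OF Q'(1) qterm_var]]])
    fix G :: "nat \<Rightarrow> nat \<Rightarrow> nat" and e :: "nat \<Rightarrow> nat"
    have *: "(\<lambda>f. case_sum G H (map_sum id \<rho> f)) = case_sum G (\<lambda>i. H (\<rho> i))" for H and \<rho> :: "nat \<Rightarrow> nat"
      by (auto simp: fun_eq_iff split: sum.split)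
    show "P G e \<or> P' G e \<longleftrightarrow> ex_all ?R G e"
      unfolding ex_all_def
    proof
      assume "P G e \<or> P' G e"
      then consider H where "\<forall>k. Q (case_sum G H) (case_sum e k)"
        | H where "\<forall>k. Q' (case_sum G H) (case_sum e k)"
        by (auto simp: Q(2) Q'(2) ex_all_def)
      then show "\<exists>H. \<forall>k. ?R (case_sum G H) (case_sum e k)"
      proof cases
        case (1 H)
        then have "\<forall>k. ?R (case_sum G (case_nat (\<lambda>_. 0) H)) (case_sum e k)" by (simp add: *)
        then show ?thesis by blast
      next
        case (2 H)
        then have "\<forall>k. ?R (case_sum G (case_nat (\<lambda>_. 1) H)) (case_sum e k)" by (simp add: *)
        then show ?thesis by blast
      qed
    next
      assume "\<exists>H. \<forall>k. ?R (case_sum G H) (case_sum e k)"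
      then obtain H where H: "\<And>k. ?R (case_sum G H) (case_sum e k)" by blast
      show "P G e \<or> P' G e"
      proof (cases "H 0 0 = 0")
        case True
        then have "\<forall>k. Q (case_sum G (\<lambda>i. H (Suc i))) (case_sum e k)"
          using H by (simp add: *)
        then show ?thesis unfolding Q(2) ex_all_def by blast
      next
        case False
        then have "\<forall>k. Q' (case_sum G (\<lambda>i. H (Suc i))) (case_sum e k)"
          using H by (simp add: *)
        then show ?thesis unfolding Q'(2) ex_all_def by blast
      qed
    qed
  qed
qed

text \<open>The number \<open>n\<close> is stored as the value at 0 of a fresh witness
  function.\<close>

lemma Sigma_pred_ex:
  assumes "Sigma_pred (\<lambda>G e. P G (\<lambda>i. e (Suc i)) (e 0))"
  shows "Sigma_pred (\<lambda>G e. \<exists>n. P G e n)"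
proof -
  obtain Q where Q: "qfree Q" "\<And>G e. P G (\<lambda>i. e (Suc i)) (e 0) \<longleftrightarrow> ex_all Q G e"
    by (rule Sigma_predE[OF assms(1)], rule that)
  have P: "P G e n \<longleftrightarrow> (\<exists>H. \<forall>k. Q (case_sum G H) (case_sum (case_nat n e) k))" for G e n
    using Q(2)[of G "case_nat n e"] by (simp add: ex_all_def)
  define V where "V v G e = (case v of Inl 0 \<Rightarrow> G (Inr 0) 0 | Inl (Suc i) \<Rightarrow> e (Inl i) | Inr i \<Rightarrow> e (Inr i))"
    for v :: "nat + nat" and G :: "nat + nat \<Rightarrow> nat \<Rightarrow> nat" and e :: "nat + nat \<Rightarrow> nat"
  have V: "qterm (V v)" for v
  proof (cases v)
    case (Inl i)
    then show ?thesis
      by (cases i) (simp_all add: V_def[abs_def] qterm_var qterm_app[OF qterm_zero])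
  qed (simp add: V_def[abs_def] qterm_var)
  show ?thesis
  proof (rule Sigma_predI)
    show "qfree (\<lambda>G e. Q (\<lambda>f. G (map_sum id Suc f)) (\<lambda>v. V v G e))" (is "qfree ?R")
      by (rule qfree_reindex[OF Q(1) V])
    fix G :: "nat \<Rightarrow> nat \<Rightarrow> nat" and e :: "nat \<Rightarrow> nat"
    have *: "(\<lambda>f. case_sum G H (map_sum id Suc f)) = case_sum G (\<lambda>i. H (Suc i))"
      "(\<lambda>v. V v (case_sum G H) (case_sum e k)) = case_sum (case_nat (H 0 0) e) k" for H k
      by (auto simp: fun_eq_iff V_def split: sum.split nat.split)
    show "(\<exists>n. P G e n) \<longleftrightarrow> ex_all ?R G e"
      unfolding ex_all_def
    proof
      assume "\<exists>n. P G e n"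
      then obtain n H where "\<forall>k. Q (case_sum G H) (case_sum (case_nat n e) k)"
        by (auto simp: P)
      then have "\<forall>k. ?R (case_sum G (case_nat (\<lambda>_. n) H)) (case_sum e k)"
        by (simp add: *)
      then show "\<exists>H. \<forall>k. ?R (case_sum G H) (case_sum e k)" by blast
    qed (unfold * P, blast)
  qed
qed

text \<open>By choice there is a witness sequence for each \<open>n\<close>. All of them fit into
  one sequence whose functions take \<open>pairing n x\<close> as argument, and \<open>n\<close>
  joins the universally quantified numbers as the first one.\<close>

lemma Sigma_pred_all:
  assumes "Sigma_pred (\<lambda>G e. P G (\<lambda>i. e (Suc i)) (e 0))"
  shows "Sigma_pred (\<lambda>G e. \<forall>n. P G e n)"
proof -
  obtain Q where Q: "qfree Q" "\<And>G e. P G (\<lambda>i. e (Suc i)) (e 0) \<longleftrightarrow> ex_all Q G e"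
    by (rule Sigma_predE[OF assms(1)], rule that)
  have P: "P G e n \<longleftrightarrow> (\<exists>H. \<forall>k. Q (case_sum G H) (case_sum (case_nat n e) k))" for G e n
    using Q(2)[of G "case_nat n e"] by (simp add: ex_all_def)
  define V where "V v G e = (case v of Inl 0 \<Rightarrow> e (Inr 0) | Inl (Suc i) \<Rightarrow> e (Inl i) | Inr i \<Rightarrow> e (Inr (Suc i)))"
    for v :: "nat + nat" and G :: "nat + nat \<Rightarrow> nat \<Rightarrow> nat" and e :: "nat + nat \<Rightarrow> nat"
  define F where "F f G e x = (case f of Inl i \<Rightarrow> G (Inl i) x | Inr i \<Rightarrow> G (Inr i) (pairing (e (Inr 0)) x))"
    for f :: "nat + nat" and G :: "nat + nat \<Rightarrow> nat \<Rightarrow> nat" and e :: "nat + nat \<Rightarrow> nat" and x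
  have V: "qterm (V v)" for v
  proof (cases v)
    case (Inl i)
    then show ?thesis
      by (cases i) (simp_all add: V_def[abs_def] qterm_var qterm_app[OF qterm_zero])
  qed (simp add: V_def[abs_def] qterm_var)
  have F: "qterm (\<lambda>G e. F f G e (u G e))" if "qterm u" for f u
    using that by (cases f) (simp_all add: F_def[abs_def] qterm_app qterm_pairing qterm_var)
  show ?thesis
  proof (rule Sigma_predI)
    show "qfree (\<lambda>G e. Q (\<lambda>f. F f G e) (\<lambda>v. V v G e))" (is "qfree ?R")
      by (rule qfree_subst[OF Q(1) F V])
    fix G :: "nat \<Rightarrow> nat \<Rightarrow> nat" and e :: "nat \<Rightarrow> nat"
    have *: "(\<lambda>f. F f (case_sum G H) (case_sum e k)) = case_sum G (\<lambda>i x. H i (pairing (k 0) x))"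
      "(\<lambda>v. V v (case_sum G H) (case_sum e k)) = case_sum (case_nat (k 0) e) (\<lambda>i. k (Suc i))" for H k
      by (auto simp: fun_eq_iff V_def F_def split: sum.split nat.split)
    show "(\<forall>n. P G e n) \<longleftrightarrow> ex_all ?R G e"
      unfolding ex_all_def
    proof
      assume "\<forall>n. P G e n"
      then obtain H where "\<forall>n k. Q (case_sum G (H n)) (case_sum (case_nat n e) k)"
        unfolding P by metis
      then have "\<forall>k. ?R (case_sum G (\<lambda>i y. case prod_decode (y div 2) of (n, x) \<Rightarrow> H n i x)) (case_sum e k)"
        by (simp add: *)
      then show "\<exists>H. \<forall>k. ?R (case_sum G H) (case_sum e k)" by blast
    next
      assume "\<exists>H. \<forall>k. ?R (case_sum G H) (case_sum e k)"
      then obtain H where H: "\<And>k. ?R (case_sum G H) (case_sum e k)" by blast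
      show "\<forall>n. P G e n"
        unfolding P
      proof (intro allI exI)
        fix n k
        show "Q (case_sum G (\<lambda>i x. H i (pairing n x))) (case_sum (case_nat n e) k)"
          using H[of "case_nat n k"] by (simp add: *)
      qed
    qed
  qed
qed

lemma Sigma_pred_exf:
  assumes "Sigma_pred (\<lambda>G e. P (\<lambda>i. G (Suc i)) e (G 0))"
  shows "Sigma_pred (\<lambda>G e. \<exists>h. P G e h)"
proof -
  obtain Q where Q: "qfree Q" "\<And>G e. P (\<lambda>i. G (Suc i)) e (G 0) \<longleftrightarrow> ex_all Q G e"
    by (rule Sigma_predE[OF assms(1)], rule that)
  have P: "P G e h \<longleftrightarrow> (\<exists>H. \<forall>k. Q (case_sum (case_nat h G) H) (case_sum e k))" for G e h
    using Q(2)[of "case_nat h G" e] by (simp add: ex_all_def)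
  define \<pi> where "\<pi> f = (case f of Inl 0 \<Rightarrow> Inr 0 | Inl (Suc i) \<Rightarrow> Inl i | Inr i \<Rightarrow> Inr (Suc i))"
    for f :: "nat + nat"
  show ?thesis
  proof (rule Sigma_predI)
    show "qfree (\<lambda>G e. Q (\<lambda>f. G (\<pi> f)) (\<lambda>v. e v))" (is "qfree ?R")
      by (rule qfree_reindex[OF Q(1) qterm_var])
    fix G :: "nat \<Rightarrow> nat \<Rightarrow> nat" and e :: "nat \<Rightarrow> nat"
    have *: "(\<lambda>f. case_sum G H (\<pi> f)) = case_sum (case_nat (H 0) G) (\<lambda>i. H (Suc i))" for H
      by (auto simp: fun_eq_iff \<pi>_def split: sum.split nat.split)
    show "(\<exists>h. P G e h) \<longleftrightarrow> ex_all ?R G e"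
      unfolding ex_all_def
    proof
      assume "\<exists>h. P G e h"
      then obtain h H where "\<forall>k. Q (case_sum (case_nat h G) H) (case_sum e k)"
        by (auto simp: P)
      then have "\<forall>k. ?R (case_sum G (case_nat h H)) (case_sum e k)"
        by (simp add: *)
      then show "\<exists>H. \<forall>k. ?R (case_sum G H) (case_sum e k)" by blast
    qed (unfold * P, blast)
  qed
qed

section \<open>Translation between normal forms and formulas of second-order arithmetic\<close>

lemma qfree_formula:
  assumes "qfree Q" shows "\<exists>\<phi>. \<forall>F e. holds F e \<phi> \<longleftrightarrow> Q F e"
proof -
  have term_ex: "\<exists>t. \<forall>F e. tm_val F e t = u F e" if "qterm u" for u
    using that
  proof induction
    case (qterm_var v)
    then show ?case by (intro exI[of _ "Var v"]) simp
  next
    case qterm_zero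
    then show ?case by (intro exI[of _ Zero]) simp
  next
    case qterm_one
    then show ?case by (intro exI[of _ One]) simp
  next
    case (qterm_plus t u)
    then obtain t' u' where "\<forall>F e. tm_val F e t' = t F e" "\<forall>F e. tm_val F e u' = u F e" by metis
    then show ?case by (intro exI[of _ "Plus t' u'"]) simp
  next
    case (qterm_times t u)
    then obtain t' u' where "\<forall>F e. tm_val F e t' = t F e" "\<forall>F e. tm_val F e u' = u F e" by metis
    then show ?case by (intro exI[of _ "Times t' u'"]) simp
  next
    case (qterm_power t u)
    then obtain t' u' where "\<forall>F e. tm_val F e t' = t F e" "\<forall>F e. tm_val F e u' = u F e" by metis
    then show ?case by (intro exI[of _ "Power t' u'"]) simp
  next
    case (qterm_app t f)
    then obtain t' where "\<forall>F e. tm_val F e t' = t F e" by metis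
    then show ?case by (intro exI[of _ "Ap f t'"]) simp
  qed
  show ?thesis
    using assms
  proof induction
    case (qfree_eq t u)
    obtain t' u' where "\<forall>F e. tm_val F e t' = t F e" "\<forall>F e. tm_val F e u' = u F e"
      using term_ex[OF qfree_eq(1)] term_ex[OF qfree_eq(2)] by metis
    then show ?case by (intro exI[of _ "Equal t' u'"]) simp
  next
    case (qfree_less t u)
    obtain t' u' where "\<forall>F e. tm_val F e t' = t F e" "\<forall>F e. tm_val F e u' = u F e"
      using term_ex[OF qfree_less(1)] term_ex[OF qfree_less(2)] by metis
    then show ?case by (intro exI[of _ "Less t' u'"]) simp
  next
    case (qfree_neg P)
    then obtain \<phi> where "\<forall>F e. holds F e \<phi> \<longleftrightarrow> P F e" by metis
    then show ?case by (intro exI[of _ "Neg \<phi>"]) simp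
  next
    case (qfree_conj P Q)
    then obtain \<phi> \<psi> where "\<forall>F e. holds F e \<phi> \<longleftrightarrow> P F e" "\<forall>F e. holds F e \<psi> \<longleftrightarrow> Q F e" by metis
    then show ?case by (intro exI[of _ "Conj \<phi> \<psi>"]) simp
  qed
qed

text \<open>Closes a formula universally in the variables below \<open>N\<close>. With
  \<open>N\<close> beyond all variables of the formula this expresses the quantification over the
  infinite tuple in \<open>ex_all\<close>.\<close>

primrec all_below :: "nat \<Rightarrow> aform \<Rightarrow> aform" where
  "all_below 0 \<phi> = \<phi>"
| "all_below (Suc N) \<phi> = Neg (Exists N (Neg (all_below N \<phi>)))"

lemma holds_all_below:
  "holds F e (all_below N \<phi>) \<longleftrightarrow> (\<forall>e'. (\<forall>i\<ge>N. e' i = e i) \<longrightarrow> holds F e' \<phi>)"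
proof (induction N arbitrary: e)
  case 0
  have "(\<forall>i\<ge>0::nat. e' i = e i) \<longleftrightarrow> e' = e" for e' by (auto simp: fun_eq_iff)
  then show ?case by simp
next
  case (Suc N)
  have "(\<exists>m. \<forall>i\<ge>N. e' i = (e(N := m)) i) \<longleftrightarrow> (\<forall>i\<ge>Suc N. e' i = e i)" for e'
  proof
    assume *: "\<forall>i\<ge>Suc N. e' i = e i"
    then have "\<forall>i\<ge>N. e' i = (e(N := e' N)) i" by (auto simp: Suc_le_eq)
    then show "\<exists>m. \<forall>i\<ge>N. e' i = (e(N := m)) i" by blast
  qed auto
  then have "(\<forall>m e'. (\<forall>i\<ge>N. e' i = (e(N := m)) i) \<longrightarrow> holds F e' \<phi>) \<longleftrightarrow>
      (\<forall>e'. (\<forall>i\<ge>Suc N. e' i = e i) \<longrightarrow> holds F e' \<phi>)" by meson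
  then show ?case by (simp only: Suc.IH all_below.simps holds.simps not_ex not_not)
qed

primrec tm_bound :: "aterm \<Rightarrow> nat" where
  "tm_bound (Var j) = Suc j"
| "tm_bound Zero = 0"
| "tm_bound One = 0"
| "tm_bound (Plus t u) = max (tm_bound t) (tm_bound u)"
| "tm_bound (Times t u) = max (tm_bound t) (tm_bound u)"
| "tm_bound (Power t u) = max (tm_bound t) (tm_bound u)"
| "tm_bound (Ap f t) = tm_bound t"

primrec var_bound :: "aform \<Rightarrow> nat" where
  "var_bound (Equal t u) = max (tm_bound t) (tm_bound u)"
| "var_bound (Less t u) = max (tm_bound t) (tm_bound u)"
| "var_bound (Neg \<phi>) = var_bound \<phi>"
| "var_bound (Conj \<phi> \<psi>) = max (var_bound \<phi>) (var_bound \<psi>)"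
| "var_bound (Exists j \<phi>) = var_bound \<phi>"

lemma tm_val_cong: "(\<And>i. i < tm_bound t \<Longrightarrow> e i = e' i) \<Longrightarrow> tm_val F e t = tm_val F e' t"
  by (induction t) simp_all

lemma holds_cong: "(\<And>i. i < var_bound \<phi> \<Longrightarrow> e i = e' i) \<Longrightarrow> holds F e \<phi> = holds F e' \<phi>"
proof (induction \<phi> arbitrary: e e')
  case (Equal t u)
  have "tm_val F e t = tm_val F e' t" "tm_val F e u = tm_val F e' u"
    by (rule tm_val_cong, rule Equal, simp)+
  then show ?case by (simp only: holds.simps)
next
  case (Less t u)
  have "tm_val F e t = tm_val F e' t" "tm_val F e u = tm_val F e' u"
    by (rule tm_val_cong, rule Less, simp)+
  then show ?case by (simp only: holds.simps)
next
  case (Neg \<phi>)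
  have "holds F e \<phi> = holds F e' \<phi>" by (rule Neg.IH, rule Neg.prems, simp)
  then show ?case by (simp only: holds.simps)
next
  case (Conj \<phi> \<psi>)
  have "holds F e \<phi> = holds F e' \<phi>" "holds F e \<psi> = holds F e' \<psi>"
    by (rule Conj.IH, rule Conj.prems, simp)+
  then show ?case by (simp only: holds.simps)
next
  case (Exists j \<phi>)
  have "holds F (e(j := m)) \<phi> = holds F (e'(j := m)) \<phi>" for m
    using Exists.prems by (intro Exists.IH) simp
  then show ?case by simp
qed

text \<open>Every positive index carries the parameter, so a predicate defines a set from
  \<open>z\<close> whatever function indices it mentions.\<close>

definition ctx :: "(nat \<Rightarrow> bool) \<Rightarrow> (nat \<Rightarrow> bool) \<Rightarrow> nat \<Rightarrow> nat \<Rightarrow> nat" where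
  "ctx x z i = (if i = 0 then (\<lambda>k. of_bool (x k)) else (\<lambda>k. of_bool (z k)))"

text \<open>Pairing folds the witness sequence into a single function \<open>w\<close>, the bound
  numbers become the variables of the formula, and the free numbers become the term 0.\<close>

lemma Sigma11_of_Sigma_pred:
  assumes "Sigma_pred P" shows "Sigma11 z {x. P (ctx x z) (\<lambda>_. 0)}"
proof -
  obtain Q where Q: "qfree Q" "\<And>G e. P G e \<longleftrightarrow> ex_all Q G e"
    by (rule Sigma_predE[OF assms(1)], rule that)
  define F where "F f G e x = (case f of Inl i \<Rightarrow> if i = 0 then G Point x else G Param x | Inr i \<Rightarrow> G Witness (pairing i x))"
    for f :: "nat + nat" and G :: "fsym \<Rightarrow> nat \<Rightarrow> nat" and e :: "nat \<Rightarrow> nat" and x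
  define V where "V v G e = (case v of Inl i \<Rightarrow> 0 | Inr i \<Rightarrow> e i)"
    for v :: "nat + nat" and G :: "fsym \<Rightarrow> nat \<Rightarrow> nat" and e :: "nat \<Rightarrow> nat"
  have V: "qterm (V v)" for v
    by (cases v) (simp_all add: V_def[abs_def] qterm_var qterm_zero)
  have F: "qterm (\<lambda>G e. F f G e (u G e))" if "qterm u" for f u
    proof (cases f)
    case (Inl i)
    then show ?thesis using that by (cases "i = 0") (simp_all add: F_def[abs_def] qterm_app)
  qed (use that in \<open>simp add: F_def[abs_def] qterm_app qterm_pairing qterm_const\<close>)
  obtain \<phi> where \<phi>: "\<And>G e. holds G e \<phi> \<longleftrightarrow> Q (\<lambda>f. F f G e) (\<lambda>v. V v G e)"
    using qfree_formula[OF qfree_subst[where F = F and V = V, OF Q(1) F V]] by auto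
  define N where "N = var_bound \<phi>"
  have all: "holds F (\<lambda>_. 0) (all_below N \<phi>) \<longleftrightarrow> (\<forall>k. holds F k \<phi>)" for F
  proof
    assume *: "holds F (\<lambda>_. 0) (all_below N \<phi>)"
    show "\<forall>k. holds F k \<phi>"
    proof
      fix k
      have "holds F (\<lambda>i. if i < N then k i else 0) \<phi>"
        using * by (simp add: holds_all_below)
      then show "holds F k \<phi>" using holds_cong[of \<phi> k "\<lambda>i. if i < N then k i else 0" F]
        by (simp add: N_def)
    qed
  qed (simp add: holds_all_below)
  have F_eq: "(\<lambda>f. F f (interp x z w) k) = case_sum (ctx x z) (\<lambda>i y. w (pairing i y))" for x w k
    by (auto simp: fun_eq_iff F_def ctx_def split: sum.split)
  have V_eq: "(\<lambda>v. V v G k) = case_sum (\<lambda>_. 0) k" for G k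
    by (auto simp: fun_eq_iff V_def split: sum.split)
  have "P (ctx x z) (\<lambda>_. 0) \<longleftrightarrow> (\<exists>w. holds (interp x z w) (\<lambda>_. 0) (all_below N \<phi>))" for x
  proof
    assume "P (ctx x z) (\<lambda>_. 0)"
    then obtain H where H: "\<And>k. Q (case_sum (ctx x z) H) (case_sum (\<lambda>_. 0) k)"
      by (auto simp: Q(2) ex_all_def)
    let ?w = "\<lambda>y. case prod_decode (y div 2) of (i, y) \<Rightarrow> H i y"
    have "holds (interp x z ?w) (\<lambda>_. 0) (all_below N \<phi>)"
      using H by (simp add: all \<phi> F_eq V_eq)
    then show "\<exists>w. holds (interp x z w) (\<lambda>_. 0) (all_below N \<phi>)" by blast
  next
    assume "\<exists>w. holds (interp x z w) (\<lambda>_. 0) (all_below N \<phi>)"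
    then show "P (ctx x z) (\<lambda>_. 0)"
      unfolding all \<phi> F_eq V_eq Q(2) ex_all_def by blast
  qed
  then show ?thesis unfolding Sigma11_def by blast
qed

primrec interp3 :: "(nat \<Rightarrow> nat) \<Rightarrow> (nat \<Rightarrow> nat) \<Rightarrow> (nat \<Rightarrow> nat) \<Rightarrow> fsym \<Rightarrow> nat \<Rightarrow> nat" where
  "interp3 X Z W Point = X"
| "interp3 X Z W Param = Z"
| "interp3 X Z W Witness = W"

lemma qterm_tm_val:
  "qterm (\<lambda>(G :: nat \<Rightarrow> nat \<Rightarrow> nat) e. tm_val (interp3 (G 1) (G 2) (G 0)) e t)"
proof (induction t)
  case (Ap f t)
  then show ?case by (cases f) (simp_all add: qterm_app del: One_nat_def)
qed (simp_all add: qterm_const qterm.intros del: One_nat_def)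

text \<open>Normal forms absorb number quantifiers of both kinds, so arithmetical predicates are
  \<open>\<Delta>\<^sup>1\<^sub>1\<close>. Formula and negation are treated together because
  \<open>Neg\<close> exchanges them. The witness has index 0, where \<open>Sigma_pred_exf\<close>
  can bind it.\<close>

lemma Sigma_pred_holds:
  "Sigma_pred (\<lambda>G e. holds (interp3 (G 1) (G 2) (G 0)) e \<phi>) \<and>
   Sigma_pred (\<lambda>G e. \<not> holds (interp3 (G 1) (G 2) (G 0)) e \<phi>)"
proof (induction \<phi>)
  case (Equal t u)
  note * = qfree_eq[OF qterm_tm_val[of t] qterm_tm_val[of u]]
  show ?case unfolding holds.simps by (rule conjI Sigma_pred_qfree qfree_neg *)+
next
  case (Less t u)
  note * = qfree_less[OF qterm_tm_val[of t] qterm_tm_val[of u]]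
  show ?case unfolding holds.simps by (rule conjI Sigma_pred_qfree qfree_neg *)+
next
  case (Neg \<phi>)
  then show ?case by simp
next
  case (Conj \<phi> \<psi>)
  then show ?case
    unfolding holds.simps de_Morgan_conj by (intro conjI Sigma_pred_conj Sigma_pred_disj) simp_all
next
  case (Exists j \<phi>)
  have V: "qterm (\<lambda>(G :: nat \<Rightarrow> nat \<Rightarrow> nat) e. ((\<lambda>i. e (Suc i))(j := e 0)) v)" for v
    by (cases "v = j") (simp_all add: qterm_var)
  have S: "Sigma_pred (\<lambda>G e. P G ((\<lambda>i. e (Suc i))(j := e 0)))" if "Sigma_pred P" for P
    by (rule Sigma_pred_subst[where V = "\<lambda>v G e. ((\<lambda>i. e (Suc i))(j := e 0)) v" and \<pi> = "\<lambda>f. f", OF that V])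
  show ?case
    unfolding holds.simps not_ex
    by (rule conjI Sigma_pred_ex Sigma_pred_all S[OF conjunct1[OF Exists]] S[OF conjunct2[OF Exists]])+
qed

text \<open>The last conclusion lets \<open>P\<close> be evaluated in environments that agree with
  \<open>ctx x z\<close> only at the indices 0 and 1, as happens after a function has been
  bound.\<close>

lemma Sigma_pred_of_Sigma11:
  assumes "Sigma11 z A"
  obtains P where "Sigma_pred P" "\<And>x. x \<in> A \<longleftrightarrow> P (ctx x z) (\<lambda>_. 0)"
    "\<And>G G' e. G 0 = G' 0 \<Longrightarrow> G 1 = G' 1 \<Longrightarrow> P G e = P G' e"
proof -
  obtain \<phi> where \<phi>: "A = {x. \<exists>w. holds (interp x z w) (\<lambda>_. 0) \<phi>}"
    using assms unfolding Sigma11_def by blast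
  let ?P = "\<lambda>G e. \<exists>w. holds (interp3 (G 0) (G 1) w) e \<phi>"
  show thesis
  proof (rule that[of ?P])
    show "Sigma_pred ?P"
      by (rule Sigma_pred_exf) (use Sigma_pred_holds[of \<phi>] in \<open>simp add: numeral_2_eq_2\<close>)
    show "x \<in> A \<longleftrightarrow> ?P (ctx x z) (\<lambda>_. 0)" for x
    proof -
      have "interp x z w = interp3 (ctx x z 0) (ctx x z 1) w" for w
      proof
        show "interp x z w f = interp3 (ctx x z 0) (ctx x z 1) w f" for f
          by (cases f) (simp_all add: ctx_def)
      qed
      then show ?thesis by (simp add: \<phi>)
    qed
  qed simp
qed

section \<open>\<open>\<Delta>\<^sup>1\<^sub>1\<close> predicates and terms\<close>

definition Delta_pred :: "((nat \<Rightarrow> nat \<Rightarrow> nat) \<Rightarrow> (nat \<Rightarrow> nat) \<Rightarrow> bool) \<Rightarrow> bool" where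
  "Delta_pred P \<longleftrightarrow> Sigma_pred P \<and> Sigma_pred (\<lambda>G e. \<not> P G e)"

text \<open>For a total function a \<open>\<Sigma>\<^sup>1\<^sub>1\<close> graph is enough:
  \<open>P\<close> at the value of \<open>t\<close> says that some \<open>n\<close> equals
  \<open>t\<close> and satisfies \<open>P\<close>, and the same form serves for the negation of
  \<open>P\<close>. Variables are in de Bruijn style, with \<open>e 0\<close> the newest.\<close>

definition Delta_term :: "((nat \<Rightarrow> nat \<Rightarrow> nat) \<Rightarrow> (nat \<Rightarrow> nat) \<Rightarrow> nat) \<Rightarrow> bool" where
  "Delta_term t \<longleftrightarrow> Sigma_pred (\<lambda>G e. e 0 = t G (\<lambda>i. e (Suc i)))"

lemma Sigma_pred_Delta: "Delta_pred P \<Longrightarrow> Sigma_pred P"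
  by (simp add: Delta_pred_def)

lemma Delta_pred_qfree: "qfree P \<Longrightarrow> Delta_pred P"
  unfolding Delta_pred_def by (intro conjI Sigma_pred_qfree qfree_neg)

lemma Delta_pred_not: "Delta_pred P \<Longrightarrow> Delta_pred (\<lambda>G e. \<not> P G e)"
  by (simp add: Delta_pred_def)

lemma Delta_pred_conj: "Delta_pred P \<Longrightarrow> Delta_pred Q \<Longrightarrow> Delta_pred (\<lambda>G e. P G e \<and> Q G e)"
  unfolding Delta_pred_def de_Morgan_conj by (elim conjE, intro conjI Sigma_pred_conj Sigma_pred_disj)

lemma Delta_pred_disj: "Delta_pred P \<Longrightarrow> Delta_pred Q \<Longrightarrow> Delta_pred (\<lambda>G e. P G e \<or> Q G e)"
  unfolding Delta_pred_def de_Morgan_disj by (elim conjE, intro conjI Sigma_pred_conj Sigma_pred_disj)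

lemma Delta_pred_imp: "Delta_pred P \<Longrightarrow> Delta_pred Q \<Longrightarrow> Delta_pred (\<lambda>G e. P G e \<longrightarrow> Q G e)"
  unfolding imp_conv_disj by (intro Delta_pred_disj Delta_pred_not)

lemma Delta_pred_ex: "Delta_pred (\<lambda>G e. P G (\<lambda>i. e (Suc i)) (e 0)) \<Longrightarrow> Delta_pred (\<lambda>G e. \<exists>n. P G e n)"
  unfolding Delta_pred_def not_ex by (elim conjE, intro conjI Sigma_pred_ex Sigma_pred_all)

lemma Delta_pred_all: "Delta_pred (\<lambda>G e. P G (\<lambda>i. e (Suc i)) (e 0)) \<Longrightarrow> Delta_pred (\<lambda>G e. \<forall>n. P G e n)"
  unfolding Delta_pred_def not_all by (elim conjE, intro conjI Sigma_pred_ex Sigma_pred_all)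

lemma Sigma_pred_imp: "Delta_pred P \<Longrightarrow> Sigma_pred Q \<Longrightarrow> Sigma_pred (\<lambda>G e. P G e \<longrightarrow> Q G e)"
  unfolding imp_conv_disj by (rule Sigma_pred_disj) (simp_all add: Delta_pred_def)

lemma Sigma_pred_let:
  assumes "Delta_term t" "Sigma_pred (\<lambda>G e. P G (\<lambda>i. e (Suc i)) (e 0))"
  shows "Sigma_pred (\<lambda>G e. P G e (t G e))"
proof -
  have "Sigma_pred (\<lambda>G e. \<exists>n. n = t G e \<and> P G e n)"
    by (rule Sigma_pred_ex, rule Sigma_pred_conj) (use assms in \<open>simp_all add: Delta_term_def\<close>)
  then show ?thesis by simp
qed

lemma Delta_pred_let:
  assumes "Delta_term t" "Delta_pred (\<lambda>G e. P G (\<lambda>i. e (Suc i)) (e 0))"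
  shows "Delta_pred (\<lambda>G e. P G e (t G e))"
  using assms(2) unfolding Delta_pred_def
  by (elim conjE, intro conjI) (erule Sigma_pred_let[OF assms(1)])+

lemma Delta_term_shift:
  assumes "Delta_term t" shows "Delta_term (\<lambda>G e. t G (\<lambda>i. e (Suc i)))"
proof -
  have V: "qterm (\<lambda>(G :: nat \<Rightarrow> nat \<Rightarrow> nat) e. case_nat (e 0) (\<lambda>i. e (Suc (Suc i))) v)" for v
    by (cases v) (simp_all add: qterm_var)
  show ?thesis
    using Sigma_pred_subst[where V = "\<lambda>v G e. case_nat (e 0) (\<lambda>i. e (Suc (Suc i))) v" and \<pi> = "\<lambda>f. f",
        OF assms[unfolded Delta_term_def] V]
    by (simp add: Delta_term_def)
qed

lemma Delta_pred_binary:
  assumes "qfree (\<lambda>G (e :: nat \<Rightarrow> nat). R G (e (Suc 0)) (e 0))" "Delta_term t" "Delta_term u"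
  shows "Delta_pred (\<lambda>G e. R G (t G e) (u G e))"
proof (rule Delta_pred_let[OF assms(2), where P = "\<lambda>G e n. R G n (u G e)"],
    rule Delta_pred_let[OF Delta_term_shift[OF assms(3)], where P = "\<lambda>G e m. R G (e 0) m"])
  show "Delta_pred (\<lambda>G e. R G (e (Suc 0)) (e 0))"
    by (rule Delta_pred_qfree[OF assms(1)])
qed

lemma Delta_term_binary:
  assumes "qfree (\<lambda>G (e :: nat \<Rightarrow> nat). e (Suc (Suc 0)) = f G (e (Suc 0)) (e 0))" "Delta_term t" "Delta_term u"
  shows "Delta_term (\<lambda>G e. f G (t G e) (u G e))"
  unfolding Delta_term_def
proof (rule Sigma_pred_let[OF Delta_term_shift[OF assms(2)], where P = "\<lambda>G e n. e 0 = f G n (u G (\<lambda>i. e (Suc i)))"],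
    rule Sigma_pred_let[OF Delta_term_shift[OF Delta_term_shift[OF assms(3)]], where P = "\<lambda>G e m. e (Suc 0) = f G (e 0) m"])
  show "Sigma_pred (\<lambda>G e. e (Suc (Suc 0)) = f G (e (Suc 0)) (e 0))"
    by (rule Sigma_pred_qfree[OF assms(1)])
qed

lemma Delta_pred_eq: "Delta_term t \<Longrightarrow> Delta_term u \<Longrightarrow> Delta_pred (\<lambda>G e. t G e = u G e)"
  by (rule Delta_pred_binary) (rule qfree_eq qterm_var)+

lemma Delta_pred_less: "Delta_term t \<Longrightarrow> Delta_term u \<Longrightarrow> Delta_pred (\<lambda>G e. t G e < u G e)"
  by (rule Delta_pred_binary) (rule qfree_less qterm_var)+

lemma Delta_pred_le: "Delta_term t \<Longrightarrow> Delta_term u \<Longrightarrow> Delta_pred (\<lambda>G e. t G e \<le> u G e)"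
  unfolding not_less[symmetric] by (intro Delta_pred_not Delta_pred_less)

lemma Delta_term_qterm:
  fixes t :: "(nat \<Rightarrow> nat \<Rightarrow> nat) \<Rightarrow> (nat \<Rightarrow> nat) \<Rightarrow> nat"
  assumes "qterm t" shows "Delta_term t"
  unfolding Delta_term_def
  by (rule Sigma_pred_qfree[OF qfree_eq[OF qterm_var qterm_subst[OF assms, where F = "\<lambda>f G e. G f" and V = "\<lambda>v G e. e (Suc v)"]]])
    (auto intro: qterm_app qterm_var)

lemma Delta_term_var: "Delta_term (\<lambda>G e. e v)"
  by (rule Delta_term_qterm[OF qterm_var])

lemma Delta_term_const: "Delta_term (\<lambda>G e. n)"
  by (rule Delta_term_qterm[OF qterm_const])

lemma Delta_term_plus: "Delta_term t \<Longrightarrow> Delta_term u \<Longrightarrow> Delta_term (\<lambda>G e. t G e + u G e)"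
  by (rule Delta_term_binary) (rule qfree_eq qterm_plus qterm_var)+

lemma Delta_term_times: "Delta_term t \<Longrightarrow> Delta_term u \<Longrightarrow> Delta_term (\<lambda>G e. t G e * u G e)"
  by (rule Delta_term_binary) (rule qfree_eq qterm_times qterm_var)+

lemma Delta_term_Suc: "Delta_term t \<Longrightarrow> Delta_term (\<lambda>G e. Suc (t G e))"
  using Delta_term_plus[OF _ Delta_term_const[of 1], of t] by simp

lemma Delta_term_power: "Delta_term t \<Longrightarrow> Delta_term u \<Longrightarrow> Delta_term (\<lambda>G e. t G e ^ u G e)"
  by (rule Delta_term_binary) (rule qfree_eq qterm_power qterm_var)+

lemma Delta_term_app: "Delta_term t \<Longrightarrow> Delta_term (\<lambda>G e. G f (t G e))"
  by (rule Delta_term_binary[where f = "\<lambda>G n m. G f n"]) (rule qfree_eq qterm_app qterm_var | assumption)+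

lemma Delta_term_pairing: "Delta_term t \<Longrightarrow> Delta_term u \<Longrightarrow> Delta_term (\<lambda>G e. pairing (t G e) (u G e))"
  by (rule Delta_term_binary) (rule qfree_eq qterm_pairing qterm_var)+

text \<open>\<open>digit c\<close> lists the digits of \<open>d\<close> in base \<open>b + 1\<close>, where \<open>c\<close> codes the pair \<open>(b, d)\<close>.\<close>

definition digit :: "nat \<Rightarrow> nat \<Rightarrow> nat" where
  "digit c i = (case prod_decode c of (b, d) \<Rightarrow> d div Suc b ^ i mod Suc b)"

text \<open>Division, remainder and decoding are eliminated in favour of addition, multiplication
  and powers under number quantifiers. The factor 2 is there because \<open>pairing\<close> is twice
  Cantor's function.\<close>

lemma digit_graph:
  "n = digit c i \<longleftrightarrow> (\<exists>b d q r. 2 * c = pairing b d \<and> d = (q * Suc b + n) * Suc b ^ i + r \<and> r < Suc b ^ i \<and> n < Suc b)"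
    (is "_ \<longleftrightarrow> ?R")
proof
  assume n: "n = digit c i"
  obtain b d where bd: "prod_decode c = (b, d)" by (cases "prod_decode c")
  then have c: "c = prod_encode (b, d)" by (metis prod_decode_inverse)
  define q r where "q = d div Suc b ^ i div Suc b" and "r = d mod Suc b ^ i"
  have "q * Suc b + n = d div Suc b ^ i"
    using n by (simp add: digit_def bd q_def del: mult_Suc_right)
  then have "d = (q * Suc b + n) * Suc b ^ i + r" by (simp only: r_def div_mult_mod_eq)
  moreover have "r < Suc b ^ i" "n < Suc b" using n by (simp_all add: r_def digit_def bd)
  ultimately show ?R using c pairing_conv by metis
next
  assume ?R
  then obtain b d q r where *: "2 * c = pairing b d" "d = (q * Suc b + n) * Suc b ^ i + r"
    "r < Suc b ^ i" "n < Suc b" by blast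
  then have "prod_decode c = (b, d)" by (simp add: pairing_conv)
  moreover have "d div Suc b ^ i = q * Suc b + n" using * by simp
  ultimately show "n = digit c i" using *(4) by (simp add: digit_def del: mult_Suc_right)
qed

lemmas Delta_term_intros = Delta_term_var Delta_term_const Delta_term_plus Delta_term_times Delta_term_power Delta_term_Suc Delta_term_app Delta_term_pairing
lemmas Delta_pred_intros = Delta_pred_conj Delta_pred_disj Delta_pred_imp Delta_pred_not Delta_pred_all Delta_pred_ex Delta_pred_eq Delta_pred_less Delta_pred_le

lemma Delta_term_digit:
  assumes "Delta_term t" "Delta_term u" shows "Delta_term (\<lambda>G e. digit (t G e) (u G e))"
  unfolding Delta_term_def
proof (rule Sigma_pred_let[OF Delta_term_shift[OF assms(1)], where P = "\<lambda>G e n. e 0 = digit n (u G (\<lambda>i. e (Suc i)))"],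
    rule Sigma_pred_let[OF Delta_term_shift[OF Delta_term_shift[OF assms(2)]], where P = "\<lambda>G e m. e (Suc 0) = digit (e 0) m"])
  show "Sigma_pred (\<lambda>G e. e (Suc (Suc 0)) = digit (e (Suc 0)) (e 0))"
    unfolding digit_graph by (rule Sigma_pred_Delta Delta_pred_intros Delta_term_intros)+
qed

section \<open>Codes of finite sequences\<close>

lemma digits_ex: "(\<And>i. f i < B) \<Longrightarrow> \<exists>d < B ^ N. \<forall>i < N. d div B ^ i mod B = (f i :: nat)"
proof (induction N)
  case (Suc N)
  then obtain d where d: "d < B ^ N" "\<forall>i < N. d div B ^ i mod B = f i" by blast
  have B: "B > 0" using Suc.prems[of 0] by simp
  let ?d = "f N * B ^ N + d"
  have "?d < B ^ Suc N"
  proof -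
    have "?d < Suc (f N) * B ^ N" using d(1) by simp
    also have "\<dots> \<le> B * B ^ N" using Suc.prems[of N] by (intro mult_right_mono) simp_all
    finally show ?thesis by simp
  qed
  moreover have "?d div B ^ i mod B = f i" if "i < Suc N" for i
  proof (cases "i = N")
    case True
    then show ?thesis using d(1) B Suc.prems[of N] by simp
  next
    case False
    then have i: "i < N" using that by simp
    then have "B ^ N = B * B ^ (N - Suc i) * B ^ i"
      by (metis Suc_diff_Suc power_Suc power_add le_add_diff_inverse2 less_imp_le_nat mult.assoc add.commute)
    \<comment> \<open>For \<open>i < N\<close> the new summand is a multiple of B to the power
      \<open>i + 1\<close>, so the digit at \<open>i\<close> does not change.\<close>
    then have "?d = d + (B * (f N * B ^ (N - Suc i))) * B ^ i"
      by (simp only: mult.assoc mult.left_commute[of B] add.commute)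
    then have "?d div B ^ i = B * (f N * B ^ (N - Suc i)) + d div B ^ i"
      using B by (simp only: div_mult_self1) simp
    then show ?thesis using d(2) i by simp
  qed
  ultimately show ?case by blast
qed simp

lemma digit_ex: "\<exists>c. \<forall>i < N. digit c i = f i"
proof -
  \<comment> \<open>The sum bounds every entry, so base \<open>b + 1\<close> is large enough.
    Setting \<open>g\<close> to 0 from \<open>N\<close> on gives a bound valid for all
    indices.\<close>
  define b where "b = (\<Sum>i<N. f i)"
  define g where "g i = (if i < N then f i else 0)" for i
  have "g i < Suc b" for i
    using member_le_sum[of i "{..<N}" f] by (auto simp: g_def b_def less_Suc_eq_le)
  then obtain d where "\<forall>i<N. d div Suc b ^ i mod Suc b = g i" using digits_ex[of g "Suc b" N] by blast
  then have "\<forall>i<N. digit (prod_encode (b, d)) i = f i" by (simp add: digit_def g_def)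
  then show ?thesis by blast
qed

section \<open>Closure properties and tree representation of lightface sets\<close>

lemma Sigma11I:
  assumes "Sigma_pred P" "\<And>x. x \<in> A \<longleftrightarrow> P (ctx x z) (\<lambda>_. 0)"
  shows "Sigma11 z A"
proof -
  have "A = {x. P (ctx x z) (\<lambda>_. 0)}" using assms(2) by auto
  then show ?thesis using Sigma11_of_Sigma_pred[OF assms(1)] by simp
qed

lemma ctx_simps: "ctx x z 0 = (\<lambda>k. of_bool (x k))" "ctx x z (Suc i) = (\<lambda>k. of_bool (z k))"
  by (simp_all add: ctx_def)

lemma Sigma11_Int:
  assumes "Sigma11 z A" "Sigma11 z B" shows "Sigma11 z (A \<inter> B)"
proof -
  obtain P where P: "Sigma_pred P" "\<And>x. x \<in> A \<longleftrightarrow> P (ctx x z) (\<lambda>_. 0)"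
    by (rule Sigma_pred_of_Sigma11[OF assms(1)], rule that)
  obtain Q where Q: "Sigma_pred Q" "\<And>x. x \<in> B \<longleftrightarrow> Q (ctx x z) (\<lambda>_. 0)"
    by (rule Sigma_pred_of_Sigma11[OF assms(2)], rule that)
  show ?thesis by (rule Sigma11I[OF Sigma_pred_conj[OF P(1) Q(1)]]) (simp add: P(2) Q(2))
qed

lemma Sigma11_INT:
  fixes n :: nat
  assumes "\<And>a. a < n \<Longrightarrow> Sigma11 z (B a)" shows "Sigma11 z {x. \<forall>a<n. x \<in> B a}"
  using assms
proof (induction n)
  case 0
  show ?case by (rule Sigma11I[OF Sigma_pred_qfree[OF qfree_True]]) simp
next
  case (Suc n)
  have "{x. \<forall>a<Suc n. x \<in> B a} = {x. \<forall>a<n. x \<in> B a} \<inter> B n" by (auto simp: less_Suc_eq)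
  then show ?case using Sigma11_Int[of z "{x. \<forall>a<n. x \<in> B a}" "B n"] Suc by simp
qed

lemma Sigma11_graft:
  assumes "Sigma11 z A" shows "Sigma11 z {x. (\<lambda>k. if k < N then s k else x k) \<in> A}"
proof -
  obtain P where P: "Sigma_pred P" "\<And>x. x \<in> A \<longleftrightarrow> P (ctx x z) (\<lambda>_. 0)"
    and P_cong: "\<And>G G' e. G 0 = G' 0 \<Longrightarrow> G 1 = G' 1 \<Longrightarrow> P G e = P G' e"
    by (rule Sigma_pred_of_Sigma11[OF assms(1)], rule that)
  obtain d where d: "\<And>i. i < N \<Longrightarrow> digit d i = of_bool (s i)"
    using digit_ex[of N "\<lambda>i. of_bool (s i)"] by blast
  \<comment> \<open>Once the grafted point \<open>Y\<close> is bound it has index 0, the original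
    point moves to 1 and the parameter to 2; \<open>\<pi>\<close> skips the original point.\<close>
  define \<pi> where "\<pi> i = (if i = 0 then 0 else 2 :: nat)" for i :: nat
  have Sigma_pred: "Sigma_pred (\<lambda>G e. \<exists>Y. (\<forall>i. (i < N \<and> Y i = digit d i) \<or> (\<not> i < N \<and> Y i = G 0 i)) \<and>
      P (\<lambda>i. case_nat Y G (\<pi> i)) e)"
  proof (rule Sigma_pred_exf, rule Sigma_pred_conj)
    show "Sigma_pred (\<lambda>G e. \<forall>i. (i < N \<and> G 0 i = digit d i) \<or> (\<not> i < N \<and> G 0 i = G (Suc 0) i))"
      by (rule Sigma_pred_Delta Delta_pred_intros Delta_term_digit Delta_term_intros)+
    have "(\<lambda>i. case_nat (G 0) (\<lambda>i. G (Suc i)) (\<pi> i)) = (\<lambda>i. G (\<pi> i))" for G :: "nat \<Rightarrow> nat \<Rightarrow> nat"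
      by (auto simp: \<pi>_def numeral_2_eq_2)
    then show "Sigma_pred (\<lambda>G e. P (\<lambda>i. case_nat (G 0) (\<lambda>i. G (Suc i)) (\<pi> i)) e)"
      using Sigma_pred_subst[where V = "\<lambda>v G e. e v" and \<pi> = \<pi>, OF P(1) qterm_var] by simp
  qed
  show ?thesis
  proof (rule Sigma11I[OF Sigma_pred])
    fix x
    let ?y = "\<lambda>k. if k < N then s k else x k"
    have "(i < N \<and> Y i = digit d i) \<or> (\<not> i < N \<and> Y i = ctx x z 0 i) \<longleftrightarrow> Y i = of_bool (?y i)" for Y i
      by (cases "i < N") (simp_all add: d ctx_simps)
    then have "(\<forall>i. (i < N \<and> Y i = digit d i) \<or> (\<not> i < N \<and> Y i = ctx x z 0 i)) \<longleftrightarrow> Y = (\<lambda>k. of_bool (?y k))" for Y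
      unfolding fun_eq_iff by (rule iff_allI)
    moreover have "P (\<lambda>i. case_nat (\<lambda>k. of_bool (?y k)) (ctx x z) (\<pi> i)) (\<lambda>_. 0) = P (ctx ?y z) (\<lambda>_. 0)"
      by (rule P_cong) (simp_all add: \<pi>_def ctx_simps numeral_2_eq_2)
    ultimately show "x \<in> {x. (\<lambda>k. if k < N then s k else x k) \<in> A} \<longleftrightarrow>
      (\<exists>Y. (\<forall>i. (i < N \<and> Y i = digit d i) \<or> (\<not> i < N \<and> Y i = ctx x z 0 i)) \<and>
        P (\<lambda>i. case_nat Y (ctx x z) (\<pi> i)) (\<lambda>_. 0))"
      by (simp add: P(2))
  qed
qed

text \<open>For fixed \<open>Z\<close>, the predicate \<open>T Z\<close> is a tree of pairs of
  finite sequences whose branches are the points of \<open>A\<close> with their witnesses. Stage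
  \<open>m\<close> demands the matrix only at those tuples \<open>k\<close> whose evaluation queries
  below \<open>m\<close>; every tuple is reached at some stage.\<close>

lemma Sigma11_tree:
  assumes "Sigma11 z A"
  obtains T where "\<And>a b c j. Delta_pred (\<lambda>G e. T (G a) (G b) (G c) (e j))"
    and "\<And>x. x \<in> A \<longleftrightarrow> (\<exists>h. \<forall>m. T (\<lambda>k. of_bool (z k)) (\<lambda>k. of_bool (x k)) h m)"
    and "\<And>Z X X' h h' m. (\<And>i. i < m \<Longrightarrow> X i = X' i) \<Longrightarrow> (\<And>i. i < m \<Longrightarrow> h i = h' i) \<Longrightarrow> T Z X h m = T Z X' h' m"
    and "\<And>Z X h m m'. m \<le> m' \<Longrightarrow> T Z X h m' \<Longrightarrow> T Z X h m"
proof -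
  obtain P where P: "Sigma_pred P" "\<And>x. x \<in> A \<longleftrightarrow> P (ctx x z) (\<lambda>_. 0)"
      "\<And>G G' e. G 0 = G' 0 \<Longrightarrow> G 1 = G' 1 \<Longrightarrow> P G e = P G' e"
    by (rule Sigma_pred_of_Sigma11[OF assms(1)], rule that)
  obtain Q where Q: "qfree Q" "\<And>G e. P G e \<longleftrightarrow> ex_all Q G e"
    by (rule Sigma_predE[OF P(1)], rule that)
  define F where "F f G e x = (case f of Inl i \<Rightarrow> if i = 0 then G 0 x else G 1 x | Inr i \<Rightarrow> G 2 (pairing i x))"
    for f :: "nat + nat" and G :: "nat \<Rightarrow> nat \<Rightarrow> nat" and e :: "nat \<Rightarrow> nat" and x
  define V where "V v G e = (case v of Inl i \<Rightarrow> 0 | Inr i \<Rightarrow> e i)"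
    for v :: "nat + nat" and G :: "nat \<Rightarrow> nat \<Rightarrow> nat" and e :: "nat \<Rightarrow> nat"
  have V: "qterm (V v)" for v
    by (cases v) (simp_all add: V_def[abs_def] qterm_var qterm_zero)
  have F: "qterm (\<lambda>G e. F f G e (u G e))" if "qterm u" for f u
  proof (cases f)
    case (Inl i)
    then show ?thesis using that by (cases "i = 0") (simp_all add: F_def[abs_def] qterm_app)
  qed (use that in \<open>simp add: F_def[abs_def] qterm_app qterm_pairing qterm_const\<close>)
  define R where "R G e = Q (\<lambda>f. F f G e) (\<lambda>v. V v G e)" for G e
  have R: "qfree R"
    unfolding R_def[abs_def] by (rule qfree_subst[where F = F and V = V, OF Q(1) F V])
  obtain B where B: "modulus B R" using qfree_modulus[OF R] by metis
  \<comment> \<open>The variable \<open>None\<close> holds the stage \<open>m\<close>, and the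
    variables \<open>Some v\<close> hold the tuple.\<close>
  define S where "S G e \<longleftrightarrow> (B (e None) G (\<lambda>v. e (Some v)) \<longrightarrow> R G (\<lambda>v. e (Some v)))" for G e
  have S: "qfree S"
    unfolding S_def[abs_def]
    by (rule qfree_imp[OF modulus_qfree[OF B] qfree_reindex[where \<pi> = "\<lambda>f. f", OF R qterm_var]])
  define g where "g X Z h = (\<lambda>i::nat. if i = 0 then X else if i = 1 then Z else h)"
    for X Z h :: "nat \<Rightarrow> nat"
  define T where "T Z X h m \<longleftrightarrow> (\<forall>k. S (g X Z h) (case_option m k))" for Z X h m
  show thesis
  proof (rule that[of T])
    fix a b c j :: nat
    define \<sigma> where "\<sigma> f = (if f = 0 then b else if f = 1 then a else c)" for f :: nat
    have \<sigma>: "(\<lambda>f. G (\<sigma> f)) = g (G b) (G a) (G c)" for G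
      by (auto simp: g_def \<sigma>_def)
    have "Sigma_pred (\<lambda>G e. T (G a) (G b) (G c) (e j))"
    proof (rule Sigma_predI)
      have V: "qterm (\<lambda>(G :: nat + nat \<Rightarrow> nat \<Rightarrow> nat) e. case_option (e (Inl j)) (\<lambda>v. e (Inr v)) v)" for v :: "nat option"
        by (cases v) (simp_all add: qterm_var)
      show "qfree (\<lambda>(G :: nat + nat \<Rightarrow> nat \<Rightarrow> nat) (e :: nat + nat \<Rightarrow> nat). S (\<lambda>f. G (Inl (\<sigma> f))) (\<lambda>v. case_option (e (Inl j)) (\<lambda>v. e (Inr v)) v))"
        by (rule qfree_reindex[OF S V])
      show "T (G a) (G b) (G c) (e j) \<longleftrightarrow>
        ex_all (\<lambda>G e. S (\<lambda>f. G (Inl (\<sigma> f))) (\<lambda>v. case_option (e (Inl j)) (\<lambda>v. e (Inr v)) v)) G e" for G e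
        by (simp add: T_def ex_all_def \<sigma>)
    qed
    moreover have "Sigma_pred (\<lambda>G e. \<not> T (G a) (G b) (G c) (e j))"
      \<comment> \<open>A tuple refuting stage \<open>m\<close> is an infinite sequence of numbers,
        hence a function that can be bound as a witness.\<close>
      unfolding T_def not_all
    proof (rule Sigma_pred_exf, rule Sigma_pred_qfree)
      have V: "qterm (\<lambda>(G :: nat \<Rightarrow> nat \<Rightarrow> nat) e. case_option (e j) (\<lambda>v. G 0 v) v)" for v :: "nat option"
        by (cases v) (simp_all add: qterm_var qterm_app qterm_const)
      have "qfree (\<lambda>G e. S (\<lambda>f. G (Suc (\<sigma> f))) (\<lambda>v. case_option (e j) (\<lambda>v. G 0 v) v))"
        by (rule qfree_reindex[OF S V])
      then show "qfree (\<lambda>G e. \<not> S (g (G (Suc b)) (G (Suc a)) (G (Suc c))) (case_option (e j) (G 0)))"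
        using \<sigma>[of "\<lambda>i. G (Suc i)" for G] by (simp add: qfree_neg)
    qed
    ultimately show "Delta_pred (\<lambda>G e. T (G a) (G b) (G c) (e j))" by (simp add: Delta_pred_def)
  next
    fix Z X h m m' assume "m \<le> m'" "T Z X h m'"
    then show "T Z X h m" using modulus_mono[OF B] by (auto simp: T_def S_def)
  next
    fix Z X X' h h' :: "nat \<Rightarrow> nat" and m
    assume X: "\<And>i. i < m \<Longrightarrow> X i = X' i" "\<And>i. i < m \<Longrightarrow> h i = h' i"
    have g: "g X Z h f i = g X' Z h' f i" "g X' Z h' f i = g X Z h f i" if "i < m" for f i
      using X that by (simp_all add: g_def)
    have "(B m (g X Z h) k \<longrightarrow> R (g X Z h) k) \<longleftrightarrow> (B m (g X' Z h') k \<longrightarrow> R (g X' Z h') k)" for k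
      using modulus_agree[OF B, of m "g X Z h" k "g X' Z h'"] modulus_agree[OF B, of m "g X' Z h'" k "g X Z h"] g
      by metis
    then show "T Z X h m = T Z X' h' m" by (simp add: T_def S_def)
  next
    fix x
    let ?g = "g (\<lambda>k. of_bool (x k)) (\<lambda>k. of_bool (z k))"
    have F_eq: "(\<lambda>f. F f (?g h) k) = case_sum (ctx x z) (\<lambda>i y. h (pairing i y))" for h k
      by (auto simp: fun_eq_iff F_def g_def ctx_def split: sum.split)
    have V_eq: "(\<lambda>v. V v G k) = case_sum (\<lambda>_. 0) k" for G k
      by (auto simp: fun_eq_iff V_def split: sum.split)
    have R_eq: "R (?g h) k \<longleftrightarrow> Q (case_sum (ctx x z) (\<lambda>i y. h (pairing i y))) (case_sum (\<lambda>_. 0) k)" for h k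
      by (simp add: R_def F_eq V_eq)
    have "x \<in> A \<longleftrightarrow> (\<exists>h. \<forall>k. R (?g h) k)"
    proof
      assume "x \<in> A"
      then obtain H where "\<And>k. Q (case_sum (ctx x z) H) (case_sum (\<lambda>_. 0) k)"
        by (auto simp: P(2) Q(2) ex_all_def)
      then have "R (?g (\<lambda>y. case prod_decode (y div 2) of (i, y) \<Rightarrow> H i y)) k" for k
        by (simp add: R_eq)
      then show "\<exists>h. \<forall>k. R (?g h) k" by blast
    next
      assume "\<exists>h. \<forall>k. R (?g h) k"
      then show "x \<in> A" unfolding P(2) Q(2) ex_all_def R_eq by blast
    qed
    moreover have "(\<forall>k. R (?g h) k) \<longleftrightarrow> (\<forall>m. T (\<lambda>k. of_bool (z k)) (\<lambda>k. of_bool (x k)) h m)" for h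
      using modulus_ex[OF B] by (auto simp: T_def S_def)
    ultimately show "x \<in> A \<longleftrightarrow> (\<exists>h. \<forall>m. T (\<lambda>k. of_bool (z k)) (\<lambda>k. of_bool (x k)) h m)" by simp
  qed
qed

subsection \<open>Simulations\<close>

text \<open>This says that the rank of \<open>a\<close> is at most the rank of \<open>b\<close>,
  where a node with an infinite chain has rank infinity. Taking the greatest fixed point makes a
  node of infinite rank simulate everything.\<close>

coinductive simulated :: "('a \<Rightarrow> 'a \<Rightarrow> bool) \<Rightarrow> ('b \<Rightarrow> 'b \<Rightarrow> bool) \<Rightarrow> 'a \<Rightarrow> 'b \<Rightarrow> bool" for r r' where
  "(\<And>a'. r a a' \<Longrightarrow> \<exists>b'. r' b b' \<and> simulated r r' a' b') \<Longrightarrow> simulated r r' a b"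

definition chain :: "('a \<Rightarrow> 'a \<Rightarrow> bool) \<Rightarrow> (nat \<Rightarrow> 'a) \<Rightarrow> bool" where
  "chain r f \<longleftrightarrow> (\<forall>n. r (f n) (f (Suc n)))"

definition has_chain :: "('a \<Rightarrow> 'a \<Rightarrow> bool) \<Rightarrow> 'a \<Rightarrow> bool" where
  "has_chain r a \<longleftrightarrow> (\<exists>f. f 0 = a \<and> chain r f)"

lemma simulatedD: "simulated r r' a b \<Longrightarrow> r a a' \<Longrightarrow> \<exists>b'. r' b b' \<and> simulated r r' a' b'"
  by (erule simulated.cases) blast

text \<open>In terms of ranks: if \<open>a\<close> is not below \<open>b\<close>, then
  \<open>b\<close> is below some successor of \<open>a\<close>.\<close>

lemma not_simulatedD:
  assumes "\<not> simulated r r' a b"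
  shows "\<exists>a'. r a a' \<and> simulated r' r b a'"
proof -
  obtain a' where a': "r a a'" "\<And>b'. r' b b' \<Longrightarrow> \<not> simulated r r' a' b'"
    using assms simulated.intros[of r a r' b] by blast
  have "simulated r' r b a'"
  \<comment> \<open>The invariant says that no successor of \<open>b\<close> simulates
    \<open>a\<close>, hence that \<open>b\<close> has rank at most that of \<open>a\<close>.\<close>
  proof (rule simulated.coinduct[where X = "\<lambda>b a. \<forall>b'. r' b b' \<longrightarrow> \<not> simulated r r' a b'"])
    show "\<forall>b'. r' b b' \<longrightarrow> \<not> simulated r r' a' b'" using a'(2) by blast
    fix b a
    assume *: "\<forall>b'. r' b b' \<longrightarrow> \<not> simulated r r' a b'"
    show "\<exists>u v. b = u \<and> a = v \<and> (\<forall>b'. r' u b' \<longrightarrow>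
        (\<exists>a'. r v a' \<and> ((\<forall>b''. r' b' b'' \<longrightarrow> \<not> simulated r r' a' b'') \<or> simulated r' r b' a')))"
    proof (rule exI[of _ b], rule exI[of _ a], intro conjI refl allI impI)
      fix b' assume "r' b b'"
      then have "\<not> simulated r r' a b'" using * by blast
      then have "\<exists>a'. r a a' \<and> (\<forall>b''. r' b' b'' \<longrightarrow> \<not> simulated r r' a' b'')"
        using simulated.intros[of r a r' b'] by blast
      then show "\<exists>a'. r a a' \<and> ((\<forall>b''. r' b' b'' \<longrightarrow> \<not> simulated r r' a' b'') \<or> simulated r' r b' a')" by blast
    qed
  qed
  then show ?thesis using a'(1) by blast
qed

lemma has_chainI:
  assumes "P a" "\<And>a. P a \<Longrightarrow> \<exists>a'. r a a' \<and> P a'"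
  shows "has_chain r a"
proof -
  have "\<exists>f. \<forall>n. (P (f n) \<and> (n = 0 \<longrightarrow> f n = a)) \<and> r (f n) (f (Suc n))"
    by (rule dependent_nat_choice) (use assms in auto)
  then show ?thesis unfolding has_chain_def chain_def by blast
qed

lemma not_wfp_chain:
  assumes "\<not> wfp (\<lambda>e c. r c e)" shows "\<exists>f. chain r f"
proof -
  have "\<exists>B. B \<noteq> {} \<and> (\<forall>c\<in>B. \<exists>e. r c e \<and> e \<in> B)"
    using assms unfolding wfp_iff_ex_minimal by simp
  then obtain B c where "c \<in> B" and B: "\<forall>c\<in>B. \<exists>e. r c e \<and> e \<in> B" by auto
  have "has_chain r c" by (rule has_chainI[where P = "\<lambda>c. c \<in> B"]) (use \<open>c \<in> B\<close> B in simp_all)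
  then show ?thesis by (auto simp: has_chain_def)
qed

text \<open>The ranks would satisfy a <= b <= a' with a' a successor of a, which is possible only at
  infinity. Concretely, the two simulations are played against each other, and the moves on the
  \<open>r\<close> side form the chain.\<close>

lemma simulated_step_has_chain:
  assumes "simulated r r' a b" "r a a'" "simulated r' r b a'"
  shows "has_chain r a"
proof (rule has_chainI[where P = "\<lambda>a. \<exists>b a'. simulated r r' a b \<and> r a a' \<and> simulated r' r b a'"])
  show "\<exists>b a'. simulated r r' a b \<and> r a a' \<and> simulated r' r b a'" using assms by blast
  fix a
  assume "\<exists>b a'. simulated r r' a b \<and> r a a' \<and> simulated r' r b a'"
  then obtain b a' where 1: "simulated r r' a b" "r a a'" "simulated r' r b a'" by blast
  obtain b' where 2: "r' b b'" "simulated r r' a' b'" using simulatedD[OF 1(1,2)] by blast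
  obtain a'' where 3: "r a' a''" "simulated r' r b' a''" using simulatedD[OF 1(3) 2(1)] by blast
  show "\<exists>a'. r a a' \<and> (\<exists>b a''. simulated r r' a' b \<and> r a' a'' \<and> simulated r' r b a'')"
    using 1(2) 2(2) 3 by blast
qed

lemma simulated_has_chain:
  assumes "simulated r r' a b" "has_chain r a"
  shows "has_chain r' b"
proof (rule has_chainI[where P = "\<lambda>b. \<exists>a. has_chain r a \<and> simulated r r' a b"])
  show "\<exists>a. has_chain r a \<and> simulated r r' a b" using assms by blast
  fix b
  assume "\<exists>a. has_chain r a \<and> simulated r r' a b"
  then obtain a f where simulated: "simulated r r' a b" and f: "f 0 = a" "chain r f" by (auto simp: has_chain_def)
  have "r a (f (Suc 0))" using f by (auto simp: chain_def)
  moreover have "chain r (\<lambda>n. f (Suc n))" using f(2) by (simp add: chain_def)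
  then have "has_chain r (f (Suc 0))" unfolding has_chain_def by (intro exI[of _ "\<lambda>n. f (Suc n)"]) simp
  ultimately show "\<exists>b'. r' b b' \<and> (\<exists>a. has_chain r a \<and> simulated r r' a b')"
    using simulatedD[OF simulated] by blast
qed

text \<open>The zeros of \<open>R\<close> form a simulation. Quantifying over such functions puts
  the coinductive predicate into \<open>\<Sigma>\<^sup>1\<^sub>1\<close> form.\<close>

lemma simulated_table:
  "simulated r r' a b \<longleftrightarrow> (\<exists>R :: nat \<Rightarrow> nat. R (pairing a b) = 0 \<and>
    (\<forall>a b. R (pairing a b) = 0 \<longrightarrow> (\<forall>a'. r a a' \<longrightarrow> (\<exists>b'. r' b b' \<and> R (pairing a' b') = 0))))"
    (is "_ \<longleftrightarrow> (\<exists>R. ?P R)")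
proof
  assume simulated: "simulated r r' a b"
  define R :: "nat \<Rightarrow> nat" where "R n = (case prod_decode (n div 2) of (a, b) \<Rightarrow> of_bool (\<not> simulated r r' a b))" for n
  have R: "R (pairing a b) = 0 \<longleftrightarrow> simulated r r' a b" for a b by (simp add: R_def)
  show "\<exists>R. ?P R"
  proof (rule exI[of _ R], intro conjI allI impI)
    show "R (pairing a b) = 0" using simulated by (simp only: R)
    fix a b a' assume "R (pairing a b) = 0" "r a a'"
    then show "\<exists>b'. r' b b' \<and> R (pairing a' b') = 0" unfolding R by (rule simulatedD)
  qed
next
  assume "\<exists>R. ?P R"
  then obtain R :: "nat \<Rightarrow> nat" where R0: "R (pairing a b) = 0"
    and R: "\<And>a b a'. R (pairing a b) = 0 \<Longrightarrow> r a a' \<Longrightarrow> \<exists>b'. r' b b' \<and> R (pairing a' b') = 0"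
    by blast
  show "simulated r r' a b"
  proof (rule simulated.coinduct[where X = "\<lambda>a b. R (pairing a b) = 0"])
    fix a b assume ab: "R (pairing a b) = 0"
    show "\<exists>u v. a = u \<and> b = v \<and>
        (\<forall>a'. r u a' \<longrightarrow> (\<exists>b'. r' v b' \<and> (R (pairing a' b') = 0 \<or> simulated r r' a' b')))"
      using R[OF ab] by (intro exI[of _ a] exI[of _ b]) blast
  qed (rule R0)
qed

lemma simulated_step:
  assumes "simulated r r' a b" "r a a'" shows "simulated r r' a' b"
proof (rule simulated.coinduct[where X = "\<lambda>a' b. \<exists>a. simulated r r' a b \<and> r a a'"])
  show "\<exists>a. simulated r r' a b \<and> r a a'" using assms by blast
  fix a' b
  assume "\<exists>a. simulated r r' a b \<and> r a a'"
  then obtain a where "simulated r r' a b" "r a a'" by blast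
  then obtain b' where "r' b b'" "simulated r r' a' b'" using simulatedD by metis
  then show "\<exists>u v. a' = u \<and> b = v \<and>
      (\<forall>a''. r u a'' \<longrightarrow> (\<exists>b'. r' v b' \<and> ((\<exists>a. simulated r r' a b' \<and> r a a'') \<or> simulated r r' a'' b')))"
    by (intro exI[of _ a'] exI[of _ b]) blast
qed

text \<open>Ranks are comparable: if \<open>b\<close> is not below \<open>a\<close>, then
  \<open>a\<close> is below a successor of \<open>b\<close>, and passing to successors of
  \<open>a\<close> only lowers its rank.\<close>

lemma simulated_linear: "simulated r r' a b \<or> simulated r' r b a"
proof (rule disjCI)
  assume "\<not> simulated r' r b a"
  from not_simulatedD[OF this] obtain b' where b': "r' b b'" "simulated r r' a b'" by blast
  show "simulated r r' a b"
  proof (rule simulated.intros)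
    fix a' assume "r a a'"
    then have "simulated r r' a' b'" by (rule simulated_step[OF b'(2)])
    then show "\<exists>b'. r' b b' \<and> simulated r r' a' b'" using b'(1) by blast
  qed
qed

subsection \<open>Nodes\<close>

text \<open>
  A number codes a family of \<open>node_width c\<close> pairs of sequences of length \<open>node_len c\<close>: for
  \<open>j < node_width c\<close> the string \<open>node_str c j\<close> and the partial witness \<open>node_wit c j\<close>. Every
  family has a code, but not a unique one.
\<close>

definition node_len :: "nat \<Rightarrow> nat" where "node_len c = digit c 0"
definition node_width :: "nat \<Rightarrow> nat" where "node_width c = digit c 1"
definition node_str :: "nat \<Rightarrow> nat \<Rightarrow> nat \<Rightarrow> nat" where "node_str c j i = digit c (2 + pairing j i)"
definition node_wit :: "nat \<Rightarrow> nat \<Rightarrow> nat \<Rightarrow> nat" where "node_wit c j i = digit c (3 + pairing j i)"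

text \<open>Values of \<open>pairing\<close> are even, so strings occupy even positions from 2 on
  and witnesses odd positions from 3 on, and nothing collides with length and width at 0 and
  1.\<close>

lemma node_ex:
  "\<exists>c. node_len c = l \<and> node_width c = w \<and> (\<forall>j<w. \<forall>i<l. node_str c j i = S j i \<and> node_wit c j i = U j i)"
proof -
  define f where "f n = (if n = 0 then l else if n = 1 then w else
    case prod_decode ((n - 2) div 2) of (j, i) \<Rightarrow> if even n then S j i else U j i)" for n
  obtain c where c: "\<And>n. n < 4 + pairing w l \<Longrightarrow> digit c n = f n"
    using digit_ex[of "4 + pairing w l" f] by blast
  have "even (pairing j i)" for j i by (simp add: pairing_conv)
  then have f: "f (2 + pairing j i) = S j i" "f (3 + pairing j i) = U j i" for j i
    by (simp_all add: f_def pairing_conv)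
  have "node_str c j i = S j i \<and> node_wit c j i = U j i" if "j < w" "i < l" for j i
    using c[of "2 + pairing j i"] c[of "3 + pairing j i"] f[of j i] pairing_mono[of j w i l] that
    by (simp add: node_str_def node_wit_def)
  moreover have "node_len c = l" "node_width c = w" using c[of 0] c[of 1] by (simp_all add: node_len_def node_width_def f_def)
  ultimately show ?thesis by blast
qed

definition good :: "((nat \<Rightarrow> nat) \<Rightarrow> (nat \<Rightarrow> nat) \<Rightarrow> nat \<Rightarrow> bool) \<Rightarrow> nat \<Rightarrow> bool" where
  "good T c \<longleftrightarrow> 0 < node_width c \<and>
    (\<forall>j. j < node_width c \<longrightarrow> (\<forall>i. i < node_len c \<longrightarrow> node_str c j i < 2) \<and> T (node_str c j) (node_wit c j) (node_len c))"

text \<open>One attempt to follow the tail of \<open>y\<close>: every string receives the next digit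
  of \<open>y\<close>, while the new values of the partial witnesses are free. An infinite chain
  from \<open>c\<close> therefore turns every member, continued by \<open>y\<close>, into a branch
  of \<open>T\<close>.\<close>

definition step :: "((nat \<Rightarrow> nat) \<Rightarrow> (nat \<Rightarrow> nat) \<Rightarrow> nat \<Rightarrow> bool) \<Rightarrow> (nat \<Rightarrow> nat) \<Rightarrow> nat \<Rightarrow> nat \<Rightarrow> bool" where
  "step T y c e \<longleftrightarrow> good T e \<and> node_len e = Suc (node_len c) \<and> node_width e = node_width c \<and>
    (\<forall>j. j < node_width c \<longrightarrow> node_str e j (node_len c) = y (node_len c) \<and>
      (\<forall>i. i < node_len c \<longrightarrow> node_str e j i = node_str c j i \<and> node_wit e j i = node_wit c j i))"

text \<open>Member \<open>j\<close> of \<open>c\<close> is continued to the members \<open>j\<close>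
  and \<open>node_width c + j\<close>. Within each half all strings receive the same new digits, and
  the two continuations first differ at \<open>p\<close>, with 0 in the first half and 1 in the
  second. The new witness values may vary with the member.\<close>

definition child :: "((nat \<Rightarrow> nat) \<Rightarrow> (nat \<Rightarrow> nat) \<Rightarrow> nat \<Rightarrow> bool) \<Rightarrow> nat \<Rightarrow> nat \<Rightarrow> bool" where
  "child T c e \<longleftrightarrow> good T e \<and> node_width e = 2 * node_width c \<and>
    (\<exists>p. node_len c \<le> p \<and> p < node_len e \<and>
      (\<forall>j. j < node_width c \<longrightarrow>
        (\<forall>i. i < node_len c \<longrightarrow> node_str e j i = node_str c j i \<and> node_str e (node_width c + j) i = node_str c j i \<and>
          node_wit e j i = node_wit c j i \<and> node_wit e (node_width c + j) i = node_wit c j i) \<and>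
        (\<forall>i. node_len c \<le> i \<longrightarrow> i < node_len e \<longrightarrow>
          node_str e j i = node_str e 0 i \<and> node_str e (node_width c + j) i = node_str e (node_width c) i)) \<and>
      (\<forall>i. node_len c \<le> i \<longrightarrow> i < p \<longrightarrow> node_str e 0 i = node_str e (node_width c) i) \<and>
      node_str e 0 p = 0 \<and> node_str e (node_width c) p = 1)"

text \<open>
  The points \<open>mod_by y d\<close> form the \<open>E\<^sub>0\<close>-class of \<open>y\<close> in \<open>\<omega>\<^sup>\<omega>\<close>. The members outside \<open>2\<^sup>\<omega>\<close> are harmless,
  because good nodes only carry binary strings.
\<close>

definition mod_by :: "(nat \<Rightarrow> nat) \<Rightarrow> nat \<Rightarrow> nat \<Rightarrow> nat" where
  "mod_by y d i = (if i < digit d 0 then digit d (Suc i) else y i)"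

definition differ :: "(nat \<Rightarrow> nat) \<Rightarrow> nat \<Rightarrow> nat \<Rightarrow> nat \<Rightarrow> bool" where
  "differ x c d d' \<longleftrightarrow> (\<exists>i. node_len c \<le> i \<and> mod_by x d i \<noteq> mod_by x d' i)"

text \<open>The tree of \<open>mod_by x d\<close> at \<open>c\<close> has strictly larger rank than
  that of any other member of the class. Only differences from \<open>node_len c\<close> on matter,
  because steps from \<open>c\<close> read nothing earlier.\<close>

definition selects :: "((nat \<Rightarrow> nat) \<Rightarrow> (nat \<Rightarrow> nat) \<Rightarrow> nat \<Rightarrow> bool) \<Rightarrow> (nat \<Rightarrow> nat) \<Rightarrow> nat \<Rightarrow> nat \<Rightarrow> bool" where
  "selects T x d c \<longleftrightarrow> (\<forall>d'. differ x c d d' \<longrightarrow>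
    \<not> simulated (step T (mod_by x d)) (step T (mod_by x d')) c c)"

definition covered :: "((nat \<Rightarrow> nat) \<Rightarrow> (nat \<Rightarrow> nat) \<Rightarrow> nat \<Rightarrow> bool) \<Rightarrow> (nat \<Rightarrow> nat) \<Rightarrow> nat \<Rightarrow> bool" where
  "covered T x c \<longleftrightarrow> (\<exists>e d. (child T)\<^sup>*\<^sup>* c e \<and> selects T x d e)"

lemma covered_iff: "covered T x c \<longleftrightarrow> (\<exists>d. selects T x d c) \<or> (\<exists>e. child T c e \<and> covered T x e)"
proof
  assume "covered T x c"
  then obtain e d where "(child T)\<^sup>*\<^sup>* c e" "selects T x d e" unfolding covered_def by blast
  then show "(\<exists>d. selects T x d c) \<or> (\<exists>e. child T c e \<and> covered T x e)"
    unfolding covered_def by (cases rule: converse_rtranclpE) blast+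
qed (auto simp: covered_def intro: converse_rtranclp_into_rtranclp)

text \<open>A positive form of strict comparison: the rank for \<open>d'\<close> at \<open>c\<close>
  is at most the rank for \<open>d\<close> at a successor of \<open>c\<close>. It can disagree with
  the negated simulation only when ranks are infinite.\<close>

definition outranks :: "((nat \<Rightarrow> nat) \<Rightarrow> (nat \<Rightarrow> nat) \<Rightarrow> nat \<Rightarrow> bool) \<Rightarrow> (nat \<Rightarrow> nat) \<Rightarrow> nat \<Rightarrow> nat \<Rightarrow> nat \<Rightarrow> bool" where
  "outranks T x d' d c \<longleftrightarrow> (\<exists>e. step T (mod_by x d) c e \<and> simulated (step T (mod_by x d')) (step T (mod_by x d)) c e)"

text \<open>
  The two clauses only use comparisons positively, so they are \<open>\<Sigma>\<^sup>1\<^sub>1\<close>; along the recursion they are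
  complementary by \<open>outranks_iff\<close> below.
\<close>

definition valid :: "((nat \<Rightarrow> nat) \<Rightarrow> (nat \<Rightarrow> nat) \<Rightarrow> nat \<Rightarrow> bool) \<Rightarrow> (nat \<Rightarrow> nat) \<Rightarrow> (nat \<Rightarrow> nat) \<Rightarrow> bool" where
  "valid T x \<tau> \<longleftrightarrow> (\<forall>c.
    (0 < \<tau> c \<and> ((\<exists>e. child T c e \<and> 0 < \<tau> e) \<or> (\<exists>d. \<forall>d'. differ x c d d' \<longrightarrow> outranks T x d' d c))) \<or>
    (\<tau> c = 0 \<and> (\<forall>e. child T c e \<longrightarrow> \<tau> e = 0) \<and>
      (\<forall>d. \<exists>d'. differ x c d d' \<and> simulated (step T (mod_by x d)) (step T (mod_by x d')) c c)))"

lemma minimal_covered: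
  assumes "wfp (\<lambda>e c. child T c e)" "covered T x c0"
  shows "\<exists>c d. (\<forall>e. child T c e \<longrightarrow> \<not> covered T x e) \<and> selects T x d c"
proof -
  have "{c. covered T x c} \<noteq> {}" using assms(2) by blast
  from assms(1)[unfolded wfp_iff_ex_minimal, rule_format, OF this]
  obtain c where "covered T x c" "\<forall>e. child T c e \<longrightarrow> \<not> covered T x e" by auto
  then show ?thesis using covered_iff[of T x c] by blast
qed

section \<open>Realized nodes and the recursion for coverage\<close>

locale closed_tree =
  fixes T :: "(nat \<Rightarrow> nat) \<Rightarrow> (nat \<Rightarrow> nat) \<Rightarrow> nat \<Rightarrow> bool"
  assumes T_cong: "\<And>X X' h h' m. (\<And>i. i < m \<Longrightarrow> X i = X' i) \<Longrightarrow> (\<And>i. i < m \<Longrightarrow> h i = h' i) \<Longrightarrow>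
      T X h m = T X' h' m"
    and T_mono: "\<And>X h m m'. m \<le> m' \<Longrightarrow> T X h m' \<Longrightarrow> T X h m"
begin

context
  fixes y :: "nat \<Rightarrow> nat" and f :: "nat \<Rightarrow> nat"
  assumes chain: "chain (step T y) f"
begin

lemma chain_step: "step T y (f n) (f (Suc n))"
  using chain by (simp add: chain_def)

lemma chain_len: "node_len (f n) = node_len (f 0) + n" and chain_wid: "node_width (f n) = node_width (f 0)"
  using chain_step by (induction n) (simp_all add: step_def)

lemma chain_good: "0 < n \<Longrightarrow> good T (f n)"
  using chain_step[of "n - 1"] by (simp add: step_def)

lemma chain_extend:
  "n \<le> m \<Longrightarrow> j < node_width (f 0) \<Longrightarrow> i < node_len (f n) \<Longrightarrow> node_str (f m) j i = node_str (f n) j i \<and> node_wit (f m) j i = node_wit (f n) j i"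
proof (induction m rule: dec_induct)
  case (step m)
  then show ?case using chain_step[of m] by (simp add: step_def chain_len[of m] chain_len[of n] chain_wid[of m])
qed simp

lemma chain_sq:
  assumes "j < node_width (f 0)" "node_len (f 0) \<le> i" "i < node_len (f n)"
  shows "node_str (f n) j i = y i"
proof -
  define k where "k = i - node_len (f 0)"
  have i: "i = node_len (f k)" using assms(2) by (simp add: chain_len[of "i - node_len (f 0)"] k_def)
  have "Suc k \<le> n" using assms by (simp add: chain_len[of n] k_def)
  then have "node_str (f n) j i = node_str (f (Suc k)) j i"
    using chain_extend[of "Suc k" n j i] assms(1) by (simp add: chain_len[of "Suc k"] i chain_len[of k])
  then show ?thesis using chain_step[of k] assms(1) by (simp add: step_def chain_wid[of k] i)
qed

end

text \<open>Two realizations of \<open>c\<close> whose tails agree eventually are placed side by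
  side. Beyond the last disagreement both follow \<open>y\<close>, so the doubled family is a child
  of \<open>c\<close> that \<open>y\<close> again realizes.\<close>

lemma merge_aux:
  assumes "has_chain (step T y) c" "has_chain (step T y') c"
    and tail: "\<And>i. N \<le> i \<Longrightarrow> y i = y' i"
    and p: "node_len c \<le> p" "y p < y' p" "\<And>i. node_len c \<le> i \<Longrightarrow> i < p \<Longrightarrow> y i = y' i"
  shows "\<exists>e. child T c e \<and> has_chain (step T y) e"
proof -
  obtain f where f0: "f 0 = c" and f: "chain (step T y) f"
    using assms(1) by (auto simp: has_chain_def)
  obtain g where g0: "g 0 = c" and g: "chain (step T y') g"
    using assms(2) by (auto simp: has_chain_def)
  define W where "W = node_width c"
  \<comment> \<open>The stage at which both tails already agree and the splitting position
    \<open>p\<close> has been passed; \<open>M\<close> is the common length reached there, namely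
    \<open>max N (Suc p)\<close>.\<close>
  define k where "k = max N (Suc p) - node_len c"
  define M where "M = node_len c + k"
  have k: "0 < k" "N \<le> M" "p < M" using p(1) by (auto simp: k_def M_def)
  note fl = chain_len[OF f, unfolded f0] and gl = chain_len[OF g, unfolded g0]
  note fw = chain_wid[OF f, unfolded f0, folded W_def] and gw = chain_wid[OF g, unfolded g0, folded W_def]
  have "\<forall>n. \<exists>e. node_len e = M + n \<and> node_width e = 2 * W \<and> (\<forall>j<2 * W. \<forall>i<M + n.
      node_str e j i = (if j < W then node_str (f (k + n)) j i else node_str (g (k + n)) (j - W) i) \<and>
      node_wit e j i = (if j < W then node_wit (f (k + n)) j i else node_wit (g (k + n)) (j - W) i))"
    by (intro allI node_ex)
  from choice[OF this] obtain h where h_all: "\<forall>n. node_len (h n) = M + n \<and> node_width (h n) = 2 * W \<and>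
    (\<forall>j<2 * W. \<forall>i<M + n.
      node_str (h n) j i = (if j < W then node_str (f (k + n)) j i else node_str (g (k + n)) (j - W) i) \<and>
      node_wit (h n) j i = (if j < W then node_wit (f (k + n)) j i else node_wit (g (k + n)) (j - W) i))" ..
  then have h: "\<And>n. node_len (h n) = M + n" "\<And>n. node_width (h n) = 2 * W" by simp_all
  have hs: "node_str (h n) j i = (if j < W then node_str (f (k + n)) j i else node_str (g (k + n)) (j - W) i) \<and>
      node_wit (h n) j i = (if j < W then node_wit (f (k + n)) j i else node_wit (g (k + n)) (j - W) i)"
    if "j < 2 * W" "i < M + n" for n j i
    using h_all that by simp
  have fgood: "good T (f (k + n))" and ggood: "good T (g (k + n))" for n
    using chain_good[OF f] chain_good[OF g] k by simp_all
  have W: "0 < W" using fgood[of 0] by (simp add: good_def fw)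
  have good: "good T (h n)" for n
    unfolding good_def
  proof (intro conjI allI impI)
    show "0 < node_width (h n)" using W by (simp add: h)
    fix j assume j: "j < node_width (h n)"
    have "(\<forall>i<M + n. node_str (h n) j i < 2) \<and> T (node_str (h n) j) (node_wit (h n) j) (M + n)"
    proof (cases "j < W")
      case True
      have "T (node_str (h n) j) (node_wit (h n) j) (M + n) = T (node_str (f (k + n)) j) (node_wit (f (k + n)) j) (M + n)"
        using hs[of j _ n] True by (intro T_cong) simp_all
      then show ?thesis
        using fgood[of n] True hs[of j _ n] by (simp add: good_def fw fl M_def add.assoc)
    next
      case False
      then have j': "j - W < W" "j < 2 * W" using j by (simp_all add: h)
      have "T (node_str (h n) j) (node_wit (h n) j) (M + n) = T (node_str (g (k + n)) (j - W)) (node_wit (g (k + n)) (j - W)) (M + n)"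
        using hs[of j _ n] False j' by (intro T_cong) simp_all
      then show ?thesis
        using ggood[of n] j' False hs[of j _ n] by (simp add: good_def gw gl M_def add.assoc)
    qed
    then show "T (node_str (h n) j) (node_wit (h n) j) (node_len (h n))" "\<And>i. i < node_len (h n) \<Longrightarrow> node_str (h n) j i < 2"
      by (simp_all add: h)
  qed
  have "step T y (h n) (h (Suc n))" for n
    unfolding step_def
  proof (intro conjI allI impI)
    fix j assume "j < node_width (h n)"
    then have j: "j < 2 * W" by (simp add: h)
    show "node_str (h (Suc n)) j (node_len (h n)) = y (node_len (h n))"
    proof (cases "j < W")
      case True
      then show ?thesis
        using chain_sq[OF f, of j "M + n" "k + Suc n"] hs[of j "M + n" "Suc n"]
        by (simp add: h f0 fl M_def W_def)
    next
      case False
      then show ?thesis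
        using chain_sq[OF g, of "j - W" "M + n" "k + Suc n"] hs[of j "M + n" "Suc n"] j tail[of "M + n"] k(2)
        by (simp add: h g0 gl M_def W_def)
    qed
    fix i assume "i < node_len (h n)"
    then have i: "i < M + n" by (simp add: h)
    have "node_str (h (Suc n)) j i = node_str (h n) j i \<and> node_wit (h (Suc n)) j i = node_wit (h n) j i"
    proof (cases "j < W")
      case True
      then show ?thesis
        using chain_extend[OF f, of "k + n" "k + Suc n" j i] hs[of j i "Suc n"] hs[of j i n] i j
        by (simp add: f0 fl M_def W_def)
    next
      case False
      then show ?thesis
        using chain_extend[OF g, of "k + n" "k + Suc n" "j - W" i] hs[of j i "Suc n"] hs[of j i n] i j
        by (simp add: g0 gl M_def W_def)
    qed
    then show "node_str (h (Suc n)) j i = node_str (h n) j i" "node_wit (h (Suc n)) j i = node_wit (h n) j i" by simp_all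
  qed (simp_all add: good h)
  then have "has_chain (step T y) (h 0)" by (auto simp: has_chain_def chain_def)
  moreover have "child T c (h 0)"
  proof -
    have 1: "node_str (h 0) j i = y i \<and> node_str (h 0) (W + j) i = y' i" if "j < W" "node_len c \<le> i" "i < M" for j i
      using chain_sq[OF f, of j i k] chain_sq[OF g, of j i k] hs[of j i 0] hs[of "W + j" i 0] that
      by (simp add: f0 g0 fl gl W_def M_def)
    have 2: "node_str (h 0) j i = node_str c j i \<and> node_str (h 0) (W + j) i = node_str c j i \<and>
        node_wit (h 0) j i = node_wit c j i \<and> node_wit (h 0) (W + j) i = node_wit c j i" if "j < W" "i < node_len c" for j i
      using chain_extend[OF f, of 0 k j i] chain_extend[OF g, of 0 k j i] hs[of j i 0] hs[of "W + j" i 0] that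
      by (simp add: f0 g0 fl gl W_def M_def)
    have "node_str (h 0) W p < 2"
      using good[of 0] W k(3) by (simp add: good_def h)
    then have yp: "y p = 0" "y' p = 1" using 1[of 0 p] W p k(3) by auto
    show ?thesis
      unfolding child_def W_def[symmetric]
      by (intro conjI exI[of _ p]) (use 1 2 1[of 0] W p yp k good in \<open>auto simp: h\<close>)
  qed
  ultimately show ?thesis by blast
qed

lemma merge:
  assumes "has_chain (step T y) c" "has_chain (step T y') c"
    and tail: "\<And>i. N \<le> i \<Longrightarrow> y i = y' i" and "\<exists>i. node_len c \<le> i \<and> y i \<noteq> y' i"
  shows "\<exists>e. child T c e \<and> (has_chain (step T y) e \<or> has_chain (step T y') e)"
proof -
  define p where "p = (LEAST i. node_len c \<le> i \<and> y i \<noteq> y' i)"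
  have p: "node_len c \<le> p" "y p \<noteq> y' p" using LeastI_ex[OF assms(4)] by (simp_all add: p_def)
  have less: "y i = y' i" if "node_len c \<le> i" "i < p" for i
    using not_less_Least[of i "\<lambda>i. node_len c \<le> i \<and> y i \<noteq> y' i"] that by (auto simp: p_def)
  show ?thesis
  proof (cases "y p < y' p")
    case True
    then show ?thesis using merge_aux[OF assms(1,2) tail p(1) _ less] by blast
  next
    case False
    then have "y' p < y p" using p(2) by simp
    then show ?thesis using merge_aux[OF assms(2,1) tail[symmetric] p(1) _ less[symmetric]] by blast
  qed
qed

lemma merge_mod:
  assumes "has_chain (step T (mod_by x d)) c" "has_chain (step T (mod_by x d')) c" "differ x c d d'"
  shows "\<exists>e d. child T c e \<and> has_chain (step T (mod_by x d)) e"
proof -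
  have "mod_by x d i = mod_by x d' i" if "max (digit d 0) (digit d' 0) \<le> i" for i
    using that by (simp add: mod_by_def)
  then show ?thesis using merge[OF assms(1,2) _ assms(3)[unfolded differ_def]] by blast
qed

text \<open>If \<open>c\<close> is realized by \<open>d\<close> but not covered, some other member
  has at least the rank of \<open>d\<close>, hence infinite rank. Merging the two realizes a child
  of \<open>c\<close>, which is covered by induction, and so \<open>c\<close> is covered after
  all.\<close>

lemma has_chain_covered:
  assumes wf: "wfp (\<lambda>e c. child T c e)"
  shows "has_chain (step T (mod_by x d)) c \<Longrightarrow> covered T x c"
  using wf
proof (induction c arbitrary: d rule: wfp_induct_rule)
  case (less c)
  show ?case
  proof (rule ccontr)
    assume n: "\<not> covered T x c"
    then have "\<not> selects T x d c" by (subst (asm) covered_iff) blast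
    then obtain d' where d': "differ x c d d'" "simulated (step T (mod_by x d)) (step T (mod_by x d')) c c"
      unfolding selects_def by blast
    obtain e d'' where "child T c e" "has_chain (step T (mod_by x d'')) e"
      using merge_mod[OF less.prems simulated_has_chain[OF d'(2) less.prems] d'(1)] by blast
    then show False using less.IH n by (subst (asm) (2) covered_iff) blast
  qed
qed

text \<open>
  If nothing is selected below the children of \<open>c\<close>, no two different members of the class realize
  \<open>c\<close>, so that both sides cannot be witnessed by infinite ranks.
\<close>

lemma outranks_iff:
  assumes "wfp (\<lambda>e c. child T c e)" "\<And>e. child T c e \<Longrightarrow> \<not> covered T x e" "differ x c d d'"
  shows "outranks T x d' d c \<longleftrightarrow> \<not> simulated (step T (mod_by x d)) (step T (mod_by x d')) c c"
proof
  assume "outranks T x d' d c"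
  then obtain e where e: "step T (mod_by x d) c e" "simulated (step T (mod_by x d')) (step T (mod_by x d)) c e"
    unfolding outranks_def by blast
  show "\<not> simulated (step T (mod_by x d)) (step T (mod_by x d')) c c"
  proof
    assume simulated: "simulated (step T (mod_by x d)) (step T (mod_by x d')) c c"
    have "has_chain (step T (mod_by x d)) c" by (rule simulated_step_has_chain[OF simulated e])
    then show False
      using merge_mod[OF _ simulated_has_chain[OF simulated] assms(3)] has_chain_covered[OF assms(1)] assms(2) by blast
  qed
qed (use not_simulatedD in \<open>auto simp: outranks_def\<close>)

text \<open>Positivity of \<open>\<tau>\<close> is forced along the child relation: a covered child
  decides the matter, and if there is none, \<open>outranks_iff\<close> makes the two alternatives
  at \<open>c\<close> mutually exclusive.\<close>

lemma valid_unique: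
  assumes wf: "wfp (\<lambda>e c. child T c e)" and "valid T x \<tau>"
  shows "0 < \<tau> c \<longleftrightarrow> covered T x c"
  using wf
proof (induction c rule: wfp_induct_rule)
  case (less c)
  show ?case
  proof (cases "\<exists>e. child T c e \<and> covered T x e")
    case True
    then have "covered T x c" by (subst covered_iff) blast
    moreover obtain e where "child T c e" "0 < \<tau> e" using True less by blast
    then have "0 < \<tau> c" using spec[OF assms(2)[unfolded valid_def], of c] by auto
    ultimately show ?thesis by simp
  next
    case False
    \<comment> \<open>Without a covered child at most one member of the class realizes
      \<open>c\<close>, so the strict comparison agrees with the negated simulation.\<close>
    then have outranks: "outranks T x d' d c \<longleftrightarrow> \<not> simulated (step T (mod_by x d)) (step T (mod_by x d')) c c"
      if "differ x c d d'" for d d'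
      using outranks_iff[OF wf _ that] by blast
    have zero: "\<tau> e = 0" if "child T c e" for e using less[OF that] False that by auto
    have *: "covered T x c \<longleftrightarrow> (\<exists>d. selects T x d c)"
      using covered_iff[of T x c] False by blast
    from spec[OF assms(2)[unfolded valid_def], of c] show ?thesis
    proof
      assume v: "0 < \<tau> c \<and> ((\<exists>e. child T c e \<and> 0 < \<tau> e) \<or> (\<exists>d. \<forall>d'. differ x c d d' \<longrightarrow> outranks T x d' d c))"
      then obtain d where "\<forall>d'. differ x c d d' \<longrightarrow> outranks T x d' d c" using zero by force
      then have "selects T x d c" unfolding selects_def using outranks by simp
      then show ?thesis using v * by blast
    next
      assume v: "\<tau> c = 0 \<and> (\<forall>e. child T c e \<longrightarrow> \<tau> e = 0) \<and>
        (\<forall>d. \<exists>d'. differ x c d d' \<and> simulated (step T (mod_by x d)) (step T (mod_by x d')) c c)"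
      have "\<not> selects T x d c" for d
      proof -
        obtain d' where "differ x c d d'" "simulated (step T (mod_by x d)) (step T (mod_by x d')) c c"
          using conjunct2[OF conjunct2[OF v]] by (elim allE exE conjE)
        then show ?thesis unfolding selects_def by (intro notI) (drule spec[of _ d'], simp)
      qed
      then show ?thesis using v * by simp
    qed
  qed
qed

lemma valid_ex:
  assumes wf: "wfp (\<lambda>e c. child T c e)"
  shows "valid T x (\<lambda>c. of_bool (covered T x c))"
  unfolding valid_def
proof (intro allI)
  fix c
  let ?t = "\<lambda>c. of_bool (covered T x c) :: nat"
  show "(0 < ?t c \<and> ((\<exists>e. child T c e \<and> 0 < ?t e) \<or> (\<exists>d. \<forall>d'. differ x c d d' \<longrightarrow> outranks T x d' d c))) \<or>
    (?t c = 0 \<and> (\<forall>e. child T c e \<longrightarrow> ?t e = 0) \<and>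
      (\<forall>d. \<exists>d'. differ x c d d' \<and> simulated (step T (mod_by x d)) (step T (mod_by x d')) c c))"
  proof (cases "covered T x c")
    case True
    have "\<exists>d. \<forall>d'. differ x c d d' \<longrightarrow> outranks T x d' d c" if no: "\<not> (\<exists>e. child T c e \<and> covered T x e)"
    proof -
      obtain d where "selects T x d c" using True no covered_iff[of T x c] by blast
      then have "\<forall>d'. differ x c d d' \<longrightarrow> outranks T x d' d c"
        using outranks_iff[OF wf] no unfolding selects_def by blast
      then show ?thesis by blast
    qed
    then show ?thesis using True by (simp add: of_bool_def) blast
  next
    case False
    then have "\<not> covered T x e" if "child T c e" for e using covered_iff[of T x c] that by blast
    moreover have "\<exists>d'. differ x c d d' \<and> simulated (step T (mod_by x d)) (step T (mod_by x d')) c c" for d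
      using False covered_iff[of T x c] unfolding selects_def by blast
    ultimately show ?thesis using False by simp
  qed
qed

end

subsection \<open>The tree of an infinite chain of nodes\<close>

lemma E0_node_snoc: "E0_node s v (\<sigma> @ [b]) = E0_node s v \<sigma> @ v (length \<sigma>) b"
proof -
  have "map (\<lambda>k. v k ((\<sigma> @ [b]) ! k)) [0..<length \<sigma>] = map (\<lambda>k. v k (\<sigma> ! k)) [0..<length \<sigma>]"
    by (intro map_cong) (simp_all add: nth_append)
  then show ?thesis by (simp add: E0_node_def del: map_eq_conv)
qed

lemma E0_node_Nil: "E0_node s v [] = s"
  by (simp add: E0_node_def)

lemma prefix_E0_node: "prefix (E0_node s v \<sigma>) (E0_node s v (\<sigma> @ \<tau>))"
proof (induction \<tau> rule: rev_induct)
  case (snoc b \<tau>)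
  then show ?case
    using E0_node_snoc[of s v "\<sigma> @ \<tau>" b] by (auto simp: prefix_def)
qed simp

lemma prefix_length_eq: "prefix a c \<Longrightarrow> prefix b c \<Longrightarrow> length a = length b \<Longrightarrow> a = b"
  by (auto simp: prefix_def append_eq_append_conv)

text \<open>As node lengths depend only on the level and \<open>v i b\<close> begins with
  \<open>b\<close>, the digit of a branch at position \<open>p i\<close> reveals its turn at level
  \<open>i\<close>.\<close>

lemma branch_node:
  assumes node_len: "\<And>\<sigma>. length (E0_node s v \<sigma>) = p (length \<sigma>)"
    and x: "x \<in> branches {t. \<exists>\<sigma>. prefix t (E0_node s v \<sigma>)}" and v: "\<And>k i. prefix [i] (v k i)"
  shows "E0_node s v (map (\<lambda>i. x (p i)) [0..<k]) = map x [0..<p k]"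
proof -
  obtain \<sigma> where "prefix (map x [0..<p k]) (E0_node s v \<sigma>)"
    using x by (auto simp: branches_def)
  \<comment> \<open>The node above the given prefix may have fewer than \<open>k\<close> turns;
    padding supplies enough of them without losing the prefix.\<close>
  moreover define \<tau> where "\<tau> = \<sigma> @ replicate k False"
  ultimately have 1: "prefix (map x [0..<p k]) (E0_node s v \<tau>)"
    using prefix_E0_node[of s v \<sigma> "replicate k False"] prefix_order.trans by simp
  have [simp]: "k \<le> length \<tau>" by (simp add: \<tau>_def)
  have 2: "prefix (E0_node s v (take i \<tau>)) (E0_node s v \<tau>)" for i
    using prefix_E0_node[of s v "take i \<tau>" "drop i \<tau>"] by simp
  have 3: "E0_node s v (take k \<tau>) = map x [0..<p k]"
    by (rule prefix_length_eq[OF 2 1]) (simp add: node_len min_absorb1 min_absorb2)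
  have "take k \<tau> ! i = x (p i)" if i: "i < k" for i
  proof -
    let ?\<rho> = "take k \<tau>"
    have [simp]: "min (length \<tau>) i = i"
      by (rule min_absorb2[OF order.trans[OF less_imp_le[OF i] \<open>k \<le> length \<tau>\<close>]])
    have "take (Suc i) ?\<rho> = take i ?\<rho> @ [?\<rho> ! i]"
      using i by (intro take_Suc_conv_app_nth) simp
    then have "E0_node s v (take (Suc i) ?\<rho>) = E0_node s v (take i ?\<rho>) @ v i (?\<rho> ! i)"
      using E0_node_snoc[of s v "take i ?\<rho>" "?\<rho> ! i"] i by (simp add: min_absorb1 min_absorb2)
    moreover have "prefix (E0_node s v (take (Suc i) ?\<rho>)) (E0_node s v ?\<rho>)"
      using prefix_E0_node[of s v "take (Suc i) ?\<rho>" "drop (Suc i) ?\<rho>"] by (simp only: append_take_drop_id)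
    ultimately have "prefix (E0_node s v (take i ?\<rho>) @ [?\<rho> ! i]) (map x [0..<p k])"
      unfolding 3 using v[of "?\<rho> ! i" i] by (auto simp: prefix_def)
    then obtain r where r: "map x [0..<p k] = E0_node s v (take i ?\<rho>) @ ?\<rho> ! i # r"
      by (auto simp: prefix_def)
    have l: "length (E0_node s v (take i ?\<rho>)) = p i" using i by (simp add: node_len min_absorb1 min_absorb2)
    have "map x [0..<p k] ! p i = ?\<rho> ! i" unfolding r l[symmetric] by (rule nth_append_length)
    moreover have "p i < p k" using arg_cong[OF r, of length] l by simp
    ultimately show ?thesis by simp
  qed
  then have "take k \<tau> = map (\<lambda>i. x (p i)) [0..<k]"
    by (intro nth_equalityI) simp_all
  with 3 show ?thesis by simp
qed

context closed_tree
begin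

text \<open>New digits depend on the half and not on the member, so one pair of strings serves all
  nodes of a level. The strings are cut at the splitting positions \<open>p k\<close>, starting from
  member 0 of \<open>c 0\<close>. The partial witnesses of the members along a branch cohere and
  give it a witness.\<close>

lemma tree_of_chain:
  assumes chain: "chain (child T) c" and good0: "good T (c 0)"
  obtains s v where "\<And>k i. prefix [i] (v k i)" "\<And>k. length (v k False) = length (v k True)"
    "node_len (c 0) \<le> length s"
    "\<And>x. x \<in> branches {t. \<exists>\<sigma>. prefix t (E0_node s v \<sigma>)} \<Longrightarrow> \<exists>h. \<forall>m. T (\<lambda>k. of_bool (x k)) h m"
proof -
  let ?W = "\<lambda>k. node_width (c k)"
  have child: "child T (c k) (c (Suc k))" for k using chain by (simp add: chain_def)
  have good: "good T (c k)" for k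
    using good0 child[of "k - 1"] by (cases k) (simp_all add: child_def)
  have W: "?W (Suc k) = 2 * ?W k" "0 < ?W k" for k
    using child[of k] good[of k] by (simp_all add: child_def good_def)
  have "\<forall>k. \<exists>p. node_len (c k) \<le> p \<and> p < node_len (c (Suc k)) \<and>
      (\<forall>j. j < ?W k \<longrightarrow>
        (\<forall>i. i < node_len (c k) \<longrightarrow> node_str (c (Suc k)) j i = node_str (c k) j i \<and> node_str (c (Suc k)) (?W k + j) i = node_str (c k) j i \<and>
          node_wit (c (Suc k)) j i = node_wit (c k) j i \<and> node_wit (c (Suc k)) (?W k + j) i = node_wit (c k) j i) \<and>
        (\<forall>i. node_len (c k) \<le> i \<longrightarrow> i < node_len (c (Suc k)) \<longrightarrow>
          node_str (c (Suc k)) j i = node_str (c (Suc k)) 0 i \<and> node_str (c (Suc k)) (?W k + j) i = node_str (c (Suc k)) (?W k) i)) \<and>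
      (\<forall>i. node_len (c k) \<le> i \<longrightarrow> i < p \<longrightarrow> node_str (c (Suc k)) 0 i = node_str (c (Suc k)) (?W k) i) \<and>
      node_str (c (Suc k)) 0 p = 0 \<and> node_str (c (Suc k)) (?W k) p = 1" (is "\<forall>k. \<exists>p. ?P k p")
    using child unfolding child_def by simp
  from choice[OF this] obtain p where p_all: "\<forall>k. ?P k (p k)" ..
  have p: "node_len (c k) \<le> p k" "p k < node_len (c (Suc k))"
    and p01: "node_str (c (Suc k)) 0 (p k) = 0" "node_str (c (Suc k)) (?W k) (p k) = 1" for k
    using p_all by simp_all
  have p_mono: "p k < p (Suc k)" for k using p(2)[of k] p(1)[of "Suc k"] by simp
  define off where "off b k = (if b then ?W k else 0)" for b k
  have old: "node_str (c (Suc k)) (j + off b k) i = node_str (c k) j i \<and> node_wit (c (Suc k)) (j + off b k) i = node_wit (c k) j i"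
    if "j < ?W k" "i < node_len (c k)" for j b k i
    using p_all that by (cases b) (simp_all add: off_def add.commute)
  have new: "node_str (c (Suc k)) (j + off b k) i = node_str (c (Suc k)) (off b k) i"
    if "j < ?W k" "node_len (c k) \<le> i" "i < node_len (c (Suc k))" for j b k i
  proof (cases b)
    case True
    then show ?thesis using p_all that by (simp add: off_def add.commute)
  next
    case False
    have "node_str (c (Suc k)) j i = node_str (c (Suc k)) 0 i" using p_all that by blast
    then show ?thesis using False by (simp add: off_def)
  qed
  have same: "node_str (c (Suc k)) (off b k) i = node_str (c (Suc k)) 0 i" if "node_len (c k) \<le> i" "i < p k" for b k i
    using p_all that by (simp add: off_def)
  \<comment> \<open>Below \<open>p 0\<close> both halves of \<open>c 1\<close> continue member 0 in
    the same way, so the stem can be read off there.\<close>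
  define s where "s = map (\<lambda>t. node_str (c 1) 0 t = 1) [0..<p 0]"
  \<comment> \<open>The block ends just before \<open>p (Suc k)\<close>, which is certain to lie
    within the length of the node only at index \<open>k + 2\<close>.\<close>
  define v where "v k b = map (\<lambda>t. node_str (c (Suc (Suc k))) (off b k) t = 1) [p k..<p (Suc k)]" for k b
  \<comment> \<open>The member of the node at index \<open>length \<sigma>\<close> reached from
    member 0 by the turns in \<open>\<sigma>\<close>; a turn to 1 moves to the second half.\<close>
  define idx where "idx \<sigma> = (\<Sum>i<length \<sigma>. off (\<sigma> ! i) i)" for \<sigma>
  have idx_snoc: "idx (\<sigma> @ [b]) = idx \<sigma> + off b (length \<sigma>)" for \<sigma> b
    by (simp add: idx_def nth_append)
  have idx_less: "idx \<sigma> < ?W (length \<sigma>)" for \<sigma>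
  proof (induction \<sigma> rule: rev_induct)
    case (snoc b \<sigma>)
    then show ?case by (auto simp: idx_snoc W off_def)
  qed (simp add: idx_def W)
  have off_less: "j + off b k < ?W (Suc k)" if "j < ?W k" for j b k
    using that by (simp add: off_def W)
  have keep: "node_str (c (Suc (Suc k))) j t = node_str (c (Suc k)) j t" if "j < ?W (Suc k)" "t < node_len (c (Suc k))" for j k t
    using old[of j "Suc k" t False] that by (simp add: off_def)
  have node: "E0_node s v \<sigma> = map (\<lambda>t. node_str (c (Suc (length \<sigma>))) (idx \<sigma>) t = 1) [0..<p (length \<sigma>)]" for \<sigma>
  proof (induction \<sigma> rule: rev_induct)
    case Nil
    then show ?case by (simp add: E0_node_Nil s_def idx_def)
  next
    case (snoc b \<sigma>)
    let ?k = "length \<sigma>"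
    note j = idx_less[of \<sigma>] and j' = off_less[OF idx_less[of \<sigma>], of b]
    have 1: "node_str (c (Suc (Suc ?k))) (idx \<sigma> + off b ?k) t = node_str (c (Suc ?k)) (idx \<sigma>) t" if t: "t < p ?k" for t
    proof -
      have "node_str (c (Suc (Suc ?k))) (idx \<sigma> + off b ?k) t = node_str (c (Suc ?k)) (idx \<sigma> + off b ?k) t"
        using keep[OF j'] t p(2)[of ?k] by simp
      also have "\<dots> = node_str (c (Suc ?k)) (idx \<sigma> + off False ?k) t"
      proof (cases "t < node_len (c ?k)")
        case True
        then show ?thesis using old[OF j] by simp
      next
        case False
        then show ?thesis using new[OF j, of t] same[of ?k t] t p(2)[of ?k] by simp
      qed
      finally show ?thesis by (simp add: off_def)
    qed
    have 2: "node_str (c (Suc (Suc ?k))) (idx \<sigma> + off b ?k) t = node_str (c (Suc (Suc ?k))) (off b ?k) t"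
      if t: "p ?k \<le> t" "t < p (Suc ?k)" for t
    proof (cases "t < node_len (c (Suc ?k))")
      case True
      have o: "off b ?k < ?W (Suc ?k)" using off_less[of 0 ?k b] W(2)[of ?k] by simp
      have "node_len (c ?k) \<le> t" using p(1)[of ?k] t(1) by (rule order.trans)
      then show ?thesis
        unfolding keep[OF j' True] keep[OF o True] by (rule new[OF j _ True])
    next
      case False
      have o: "off b ?k < ?W (Suc ?k)" using off_less[of 0 ?k b] W(2)[of ?k] by simp
      have "node_len (c (Suc ?k)) \<le> t" "t < node_len (c (Suc (Suc ?k)))" using False t(2) p(2)[of "Suc ?k"] by simp_all
      from new[OF j' this, of False] new[OF o this, of False] show ?thesis by (simp add: off_def split: if_splits)
    qed
    have "[0..<p (Suc ?k)] = [0..<p ?k] @ [p ?k..<p (Suc ?k)]"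
      using p_mono[of ?k] by (metis le0 less_imp_le_nat upt_add_eq_append le_add_diff_inverse)
    moreover have "map (\<lambda>t. node_str (c (Suc (Suc ?k))) (idx \<sigma> + off b ?k) t = 1) [0..<p ?k] = E0_node s v \<sigma>"
      unfolding snoc.IH by (intro map_cong) (simp_all add: 1)
    moreover have "map (\<lambda>t. node_str (c (Suc (Suc ?k))) (idx \<sigma> + off b ?k) t = 1) [p ?k..<p (Suc ?k)] = v ?k b"
      unfolding v_def by (intro map_cong) (simp_all add: 2)
    ultimately show ?case
      by (simp add: E0_node_snoc idx_snoc del: map_eq_conv)
  qed
  have v01: "prefix [b] (v k b)" for k b
  proof -
    have "node_str (c (Suc (Suc k))) (off b k) (p k) = node_str (c (Suc k)) (off b k) (p k)"
      using keep[OF off_less[of 0 k b]] W(2)[of k] p(2)[of k] by simp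
    then have "(node_str (c (Suc (Suc k))) (off b k) (p k) = 1) = b"
      using p01[of k] by (simp add: off_def)
    then show ?thesis using p_mono[of k] by (simp add: v_def upt_conv_Cons)
  qed
  show thesis
  proof (rule that[of v s])
    show "prefix [i] (v k i)" for k i by (rule v01)
    show "length (v k False) = length (v k True)" for k by (simp add: v_def)
    show "node_len (c 0) \<le> length s" using p(1)[of 0] by (simp add: s_def)
    fix x assume x: "x \<in> branches {t. \<exists>\<sigma>. prefix t (E0_node s v \<sigma>)}"
    define \<alpha> where "\<alpha> k = map (\<lambda>i. x (p i)) [0..<k]" for k
    define j where "j k = idx (\<alpha> k)" for k
    have \<alpha>_Suc: "\<alpha> (Suc k) = \<alpha> k @ [x (p k)]" for k by (simp add: \<alpha>_def)
    have [simp]: "length (\<alpha> k) = k" for k by (simp add: \<alpha>_def)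
    have j: "j k < ?W k" "j (Suc k) = j k + off (x (p k)) k" for k
      using idx_less[of "\<alpha> k"] by (simp_all add: j_def \<alpha>_Suc idx_snoc)
    have "map x [0..<p k] = map (\<lambda>t. node_str (c (Suc k)) (j k) t = 1) [0..<p k]" for k
      using branch_node[where p = p, OF _ x v01, of k] node[of "\<alpha> k"] by (simp add: node \<alpha>_def j_def)
    then have x_eq: "x t \<longleftrightarrow> node_str (c (Suc k)) (j k) t = 1" if "t < p k" for t k
      using that by simp
    have len_Suc: "node_len (c k) \<le> node_len (c (Suc k))" for k using p(1)[of k] p(2)[of k] by simp
    have coh: "node_str (c m) (j m) t = node_str (c k) (j k) t \<and> node_wit (c m) (j m) t = node_wit (c k) (j k) t"
      if "k \<le> m" "t < node_len (c k)" for k m t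
      using that
    proof (induction m rule: dec_induct)
      case (step m)
      have "node_len (c k) \<le> node_len (c m)"
        by (rule lift_Suc_mono_le[where f = "\<lambda>k. node_len (c k)", OF len_Suc step.hyps(1)])
      then have "t < node_len (c m)" using step.prems by simp
      from old[OF j(1)[of m] this, of "x (p m)"] step.IH[OF step.prems] show ?case by (simp add: j(2))
    qed simp
    have len_ge: "k \<le> node_len (c k)" for k
    proof (induction k)
      case (Suc k)
      then show ?case using p[of k] by simp
    qed simp
    \<comment> \<open>The node at index \<open>t + 1\<close> has length greater than
      \<open>t\<close>, so it carries a witness value at \<open>t\<close>; by \<open>coh\<close> the
      value is the same at all later stages.\<close>
    define h where "h t = node_wit (c (Suc t)) (j (Suc t)) t" for t
    have "T (\<lambda>k. of_bool (x k)) h m" for m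
    proof -
      have "T (node_str (c m) (j m)) (node_wit (c m) (j m)) (node_len (c m))" and b: "\<And>t. t < node_len (c m) \<Longrightarrow> node_str (c m) (j m) t < 2"
        using good[of m] j(1)[of m] by (simp_all add: good_def)
      moreover have "of_bool (x t) = node_str (c m) (j m) t" if t: "t < node_len (c m)" for t
        using x_eq[of t m] old[OF j(1)[of m] t, of False] b[OF t] p(1)[of m] t
        by (auto simp: off_def)
      moreover have "h t = node_wit (c m) (j m) t" if t: "t < node_len (c m)" for t
        using coh[of m "Suc t" t] coh[of "Suc t" m t] t len_ge[of "Suc t"]
        by (cases "m \<le> Suc t") (auto simp: h_def)
      ultimately have "T (\<lambda>k. of_bool (x k)) h (node_len (c m))" by (subst T_cong) auto
      then show ?thesis by (rule T_mono[OF len_ge])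
    qed
    then show "\<exists>h. \<forall>m. T (\<lambda>k. of_bool (x k)) h m" by blast
  qed
qed

end

subsection \<open>Definability of the selected points\<close>

lemma Delta_term_node_len: "Delta_term t \<Longrightarrow> Delta_term (\<lambda>G e. node_len (t G e))"
  and Delta_term_node_width: "Delta_term t \<Longrightarrow> Delta_term (\<lambda>G e. node_width (t G e))"
  unfolding node_len_def node_width_def by (rule Delta_term_digit Delta_term_const | assumption)+

lemma Delta_term_node_str: "Delta_term t \<Longrightarrow> Delta_term u \<Longrightarrow> Delta_term w \<Longrightarrow> Delta_term (\<lambda>G e. node_str (t G e) (u G e) (w G e))"
  and Delta_term_node_wit: "Delta_term t \<Longrightarrow> Delta_term u \<Longrightarrow> Delta_term w \<Longrightarrow> Delta_term (\<lambda>G e. node_wit (t G e) (u G e) (w G e))"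
  unfolding node_str_def node_wit_def by (rule Delta_term_digit Delta_term_plus Delta_term_pairing Delta_term_const | assumption)+

lemma mod_by_graph:
  "n = mod_by y d i \<longleftrightarrow> (i < digit d 0 \<and> n = digit d (Suc i)) \<or> (\<not> i < digit d 0 \<and> n = y i)"
  by (simp add: mod_by_def)

lemma Delta_term_mod_by:
  assumes "Delta_term t" "Delta_term u" shows "Delta_term (\<lambda>G e. mod_by (G b) (t G e) (u G e))"
  unfolding Delta_term_def mod_by_graph
  by (rule Sigma_pred_Delta Delta_pred_disj Delta_pred_conj Delta_pred_not Delta_pred_eq Delta_pred_less Delta_term_var Delta_term_digit Delta_term_Suc Delta_term_app Delta_term_const
      Delta_term_shift[OF assms(1)] Delta_term_shift[OF assms(2)])+

lemmas Delta_term_node_intros = Delta_term_node_len Delta_term_node_width Delta_term_node_str Delta_term_node_wit Delta_term_mod_by Delta_term_digit Delta_term_intros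

lemma Delta_pred_differ: "Delta_pred (\<lambda>G e. differ (G b) (e i) (e j) (e k))"
  unfolding differ_def by (rule Delta_pred_intros Delta_term_node_intros)+

locale definable_tree =
  fixes T :: "(nat \<Rightarrow> nat) \<Rightarrow> (nat \<Rightarrow> nat) \<Rightarrow> (nat \<Rightarrow> nat) \<Rightarrow> nat \<Rightarrow> bool"
  assumes Delta_pred_T: "\<And>a b c j. Delta_pred (\<lambda>G e. T (G a) (G b) (G c) (e j))"
begin

text \<open>\<open>T\<close> is known to be definable only for functions from the environment. The
  strings of a node are therefore bound as functions fixed by their values, and this form serves
  both \<open>T\<close> and its negation.\<close>

lemma Delta_pred_T_node: "Delta_pred (\<lambda>G e. T (G a) (node_str (e i) (e j)) (node_wit (e i) (e j)) (node_len (e i)))"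
proof -
  have eq: "T Z (node_str c j) (node_wit c j) (node_len c) \<longleftrightarrow>
      (\<exists>X H. ((\<forall>n. X n = node_str c j n) \<and> (\<forall>n. H n = node_wit c j n)) \<and> T Z X H (node_len c))"
    and neq: "\<not> T Z (node_str c j) (node_wit c j) (node_len c) \<longleftrightarrow>
      (\<exists>X H. ((\<forall>n. X n = node_str c j n) \<and> (\<forall>n. H n = node_wit c j n)) \<and> \<not> T Z X H (node_len c))" for Z c j
    by (auto simp flip: fun_eq_iff)
  have T: "Delta_pred (\<lambda>G e. T (G a) (G b) (G c) (node_len (e i)))" for a b c
    by (rule Delta_pred_let[OF Delta_term_node_len[OF Delta_term_var], where P = "\<lambda>G e n. T (G a) (G b) (G c) n"], rule Delta_pred_T)
  show ?thesis
    unfolding Delta_pred_def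
  proof
    show "Sigma_pred (\<lambda>G e. T (G a) (node_str (e i) (e j)) (node_wit (e i) (e j)) (node_len (e i)))"
      unfolding eq by (rule Sigma_pred_exf, rule Sigma_pred_exf) (rule Sigma_pred_Delta T Delta_pred_intros Delta_term_node_intros)+
    show "Sigma_pred (\<lambda>G e. \<not> T (G a) (node_str (e i) (e j)) (node_wit (e i) (e j)) (node_len (e i)))"
      unfolding neq by (rule Sigma_pred_exf, rule Sigma_pred_exf) (rule Sigma_pred_Delta T Delta_pred_intros Delta_term_node_intros)+
  qed
qed

lemma Delta_pred_good: "Delta_pred (\<lambda>G e. good (T (G a)) (e i))"
  unfolding good_def by (rule Delta_pred_T_node Delta_pred_intros Delta_term_node_intros)+

lemma Delta_pred_step: "Delta_pred (\<lambda>G e. step (T (G a)) (mod_by (G b) (e d)) (e i) (e j))"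
  unfolding step_def by (rule Delta_pred_good Delta_pred_intros Delta_term_node_intros)+

lemma Delta_pred_child: "Delta_pred (\<lambda>G e. child (T (G a)) (e i) (e j))"
  unfolding child_def by (rule Delta_pred_good Delta_pred_intros Delta_term_node_intros)+

lemma Sigma_pred_simulated: "Sigma_pred (\<lambda>G e. simulated (step (T (G a)) (mod_by (G b) (e d))) (step (T (G a)) (mod_by (G b) (e d'))) (e i) (e j))"
  unfolding simulated_table by (rule Sigma_pred_exf, rule Sigma_pred_Delta) (rule Delta_pred_step Delta_pred_intros Delta_term_node_intros)+

lemma Sigma_pred_outranks: "Sigma_pred (\<lambda>G e. outranks (T (G a)) (G b) (e d') (e d) (e i))"
  unfolding outranks_def by (rule Sigma_pred_ex, rule Sigma_pred_conj[OF Sigma_pred_Delta[OF Delta_pred_step] Sigma_pred_simulated])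

lemma Sigma_pred_valid: "Sigma_pred (\<lambda>G e. valid (T (G a)) (G b) (G c))"
  unfolding valid_def
  by (rule Sigma_pred_simulated Sigma_pred_outranks Sigma_pred_all Sigma_pred_disj Sigma_pred_conj Sigma_pred_ex Sigma_pred_imp
      Delta_pred_child Delta_pred_differ Delta_pred_eq Delta_pred_less Delta_term_node_intros | rule Sigma_pred_Delta)+

end

text \<open>Here \<open>c\<close> is meant to be a minimal covered node. Fixing the first
  \<open>l\<close> digits by \<open>s\<close> pushes any difference of two such points past position
  \<open>l\<close>; see \<open>selected_discrete\<close>.\<close>

definition selected :: "((nat \<Rightarrow> nat) \<Rightarrow> (nat \<Rightarrow> nat) \<Rightarrow> nat \<Rightarrow> bool) \<Rightarrow> nat \<Rightarrow> nat \<Rightarrow> nat \<Rightarrow> nat \<Rightarrow> (nat \<Rightarrow> bool) set" where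
  "selected T c d l s = {x. (\<forall>i. i < l \<longrightarrow> of_bool (x i) = digit s i) \<and>
     (\<forall>e. child T c e \<longrightarrow> \<not> covered T (\<lambda>k. of_bool (x k)) e) \<and> selects T (\<lambda>k. of_bool (x k)) d c}"

text \<open>Both membership and its failure can guess a valid \<open>\<tau>\<close> and read
  coverage of the children from it, since its positivity is unique. At \<open>c\<close> itself,
  \<open>outranks\<close> certifies selection and a simulation certifies its failure.\<close>

lemma selected_Delta11:
  assumes "definable_tree T" "closed_tree (T (\<lambda>k. of_bool (z k)))"
    and wf: "wfp (\<lambda>e c. child (T (\<lambda>k. of_bool (z k))) c e)"
  shows "Delta11 z (selected (T (\<lambda>k. of_bool (z k))) c d l s)"
proof -
  interpret definable_tree T by fact
  let ?Z = "\<lambda>k. of_bool (z k) :: nat"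
  interpret closed_tree "T ?Z" by fact
  let ?S = "selected (T ?Z) c d l s"
  let ?simulated = "\<lambda>Z X d d' c. simulated (step (T Z) (mod_by X d)) (step (T Z) (mod_by X d')) c c"
  have "Sigma_pred (\<lambda>G e. (\<forall>i. i < l \<longrightarrow> G 0 i = digit s i) \<and> (\<exists>\<tau>. valid (T (G 1)) (G 0) \<tau> \<and>
      (\<forall>e. child (T (G 1)) c e \<longrightarrow> \<tau> e = 0) \<and> (\<forall>d'. differ (G 0) c d d' \<longrightarrow> outranks (T (G 1)) (G 0) d' d c)))"
    (is "Sigma_pred ?P")
  \<comment> \<open>The constants \<open>c\<close> and \<open>d\<close> are turned into number
    variables, the form in which the definability of \<open>child\<close>, \<open>differ\<close> and
    \<open>outranks\<close> is available.\<close>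
  proof (rule Sigma_pred_let[OF Delta_term_const[of c], where P = "\<lambda>G e c. (\<forall>i. i < l \<longrightarrow> G 0 i = digit s i) \<and> (\<exists>\<tau>. valid (T (G 1)) (G 0) \<tau> \<and>
        (\<forall>e. child (T (G 1)) c e \<longrightarrow> \<tau> e = 0) \<and> (\<forall>d'. differ (G 0) c d d' \<longrightarrow> outranks (T (G 1)) (G 0) d' d c))"],
      rule Sigma_pred_let[OF Delta_term_const[of d], where P = "\<lambda>G e d. (\<forall>i. i < l \<longrightarrow> G 0 i = digit s i) \<and> (\<exists>\<tau>. valid (T (G 1)) (G 0) \<tau> \<and>
        (\<forall>e'. child (T (G 1)) (e 0) e' \<longrightarrow> \<tau> e' = 0) \<and> (\<forall>d'. differ (G 0) (e 0) d d' \<longrightarrow> outranks (T (G 1)) (G 0) d' d (e 0)))"])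
  qed (rule Sigma_pred_valid Sigma_pred_outranks Sigma_pred_all Sigma_pred_conj Sigma_pred_exf Sigma_pred_imp Delta_pred_child Delta_pred_differ Delta_pred_eq Delta_pred_less Delta_term_node_intros | rule Sigma_pred_Delta)+
  then have 1: "Sigma11 z ?S"
  proof (rule Sigma11I)
    fix x :: "nat \<Rightarrow> bool"
    let ?X = "\<lambda>k. of_bool (x k) :: nat"
    have *: "(\<forall>d'. differ ?X c d d' \<longrightarrow> outranks (T ?Z) ?X d' d c) \<longleftrightarrow> selects (T ?Z) ?X d c"
      if "\<And>e. child (T ?Z) c e \<Longrightarrow> \<not> covered (T ?Z) ?X e"
      using outranks_iff[OF wf that] by (simp add: selects_def)
    show "x \<in> ?S \<longleftrightarrow> ?P (ctx x z) (\<lambda>_. 0)"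
      unfolding One_nat_def ctx_simps
    proof
      assume "x \<in> ?S"
      then show "(\<forall>i. i < l \<longrightarrow> ?X i = digit s i) \<and> (\<exists>\<tau>. valid (T ?Z) ?X \<tau> \<and>
          (\<forall>e. child (T ?Z) c e \<longrightarrow> \<tau> e = 0) \<and> (\<forall>d'. differ ?X c d d' \<longrightarrow> outranks (T ?Z) ?X d' d c))"
        using * by (intro conjI exI[of _ "\<lambda>c. of_bool (covered (T ?Z) ?X c)"] valid_ex[OF wf])
          (simp_all add: selected_def)
    next
      assume "(\<forall>i. i < l \<longrightarrow> ?X i = digit s i) \<and> (\<exists>\<tau>. valid (T ?Z) ?X \<tau> \<and>
          (\<forall>e. child (T ?Z) c e \<longrightarrow> \<tau> e = 0) \<and> (\<forall>d'. differ ?X c d d' \<longrightarrow> outranks (T ?Z) ?X d' d c))"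
      then obtain \<tau> where \<tau>: "\<forall>i. i < l \<longrightarrow> ?X i = digit s i" "valid (T ?Z) ?X \<tau>"
        "\<And>e. child (T ?Z) c e \<Longrightarrow> \<tau> e = 0" "\<forall>d'. differ ?X c d d' \<longrightarrow> outranks (T ?Z) ?X d' d c" by blast
      have "\<not> covered (T ?Z) ?X e" if "child (T ?Z) c e" for e
        using valid_unique[OF wf \<tau>(2), of e] \<tau>(3)[OF that] by simp
      then show "x \<in> ?S" using * \<tau>(1,4) by (simp add: selected_def)
    qed
  qed
  have "Sigma_pred (\<lambda>G e. (\<exists>i. i < l \<and> \<not> G 0 i = digit s i) \<or> (\<exists>\<tau>. valid (T (G 1)) (G 0) \<tau> \<and>
      ((\<exists>e. child (T (G 1)) c e \<and> 0 < \<tau> e) \<or> (\<exists>d'. differ (G 0) c d d' \<and> ?simulated (G 1) (G 0) d d' c))))"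
    (is "Sigma_pred ?Q")
  proof (rule Sigma_pred_let[OF Delta_term_const[of c], where P = "\<lambda>G e c. (\<exists>i. i < l \<and> \<not> G 0 i = digit s i) \<or> (\<exists>\<tau>. valid (T (G 1)) (G 0) \<tau> \<and>
        ((\<exists>e. child (T (G 1)) c e \<and> 0 < \<tau> e) \<or> (\<exists>d'. differ (G 0) c d d' \<and> ?simulated (G 1) (G 0) d d' c)))"],
      rule Sigma_pred_let[OF Delta_term_const[of d], where P = "\<lambda>G e d. (\<exists>i. i < l \<and> \<not> G 0 i = digit s i) \<or> (\<exists>\<tau>. valid (T (G 1)) (G 0) \<tau> \<and>
        ((\<exists>e'. child (T (G 1)) (e 0) e' \<and> 0 < \<tau> e') \<or> (\<exists>d'. differ (G 0) (e 0) d d' \<and> ?simulated (G 1) (G 0) d d' (e 0))))"])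
  qed (rule Sigma_pred_valid Sigma_pred_simulated Sigma_pred_disj Sigma_pred_conj Sigma_pred_ex Sigma_pred_exf Delta_pred_not Delta_pred_child Delta_pred_differ Delta_pred_eq Delta_pred_less Delta_term_node_intros | rule Sigma_pred_Delta)+
  then have 2: "Sigma11 z (- ?S)"
  proof (rule Sigma11I)
    fix x :: "nat \<Rightarrow> bool"
    let ?X = "\<lambda>k. of_bool (x k) :: nat"
    show "x \<in> - ?S \<longleftrightarrow> ?Q (ctx x z) (\<lambda>_. 0)"
      unfolding One_nat_def ctx_simps
    proof
      assume "x \<in> - ?S"
      then show "(\<exists>i. i < l \<and> \<not> ?X i = digit s i) \<or> (\<exists>\<tau>. valid (T ?Z) ?X \<tau> \<and>
          ((\<exists>e. child (T ?Z) c e \<and> 0 < \<tau> e) \<or> (\<exists>d'. differ ?X c d d' \<and> ?simulated ?Z ?X d d' c)))"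
        using valid_ex[OF wf, of ?X] by (force simp: selected_def selects_def)
    next
      assume Q: "(\<exists>i. i < l \<and> \<not> ?X i = digit s i) \<or> (\<exists>\<tau>. valid (T ?Z) ?X \<tau> \<and>
          ((\<exists>e. child (T ?Z) c e \<and> 0 < \<tau> e) \<or> (\<exists>d'. differ ?X c d d' \<and> ?simulated ?Z ?X d d' c)))"
      show "x \<in> - ?S"
      proof
        assume S: "x \<in> ?S"
        then obtain \<tau> where \<tau>: "valid (T ?Z) ?X \<tau>"
          "(\<exists>e. child (T ?Z) c e \<and> 0 < \<tau> e) \<or> (\<exists>d'. differ ?X c d d' \<and> ?simulated ?Z ?X d d' c)"
          using Q by (auto simp: selected_def)
        have "\<not> (\<exists>e. child (T ?Z) c e \<and> 0 < \<tau> e)"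
          using S valid_unique[OF wf \<tau>(1)] by (simp add: selected_def)
        then show False using S \<tau>(2) by (auto simp: selected_def selects_def)
      qed
    qed
  qed
  show ?thesis using 1 2 by (simp add: Delta11_def)
qed

section \<open>Discreteness of the selected sets\<close>

lemma mod_by_transfer:
  assumes "\<And>k. n < k \<Longrightarrow> x k = y k"
  shows "\<exists>d'. mod_by x d' = mod_by y d"
proof -
  \<comment> \<open>\<open>M\<close> passes both the disagreements of \<open>x\<close> and
    \<open>y\<close>, which may include position \<open>n\<close>, and the prefix replaced by
    \<open>d\<close>; the code \<open>d'\<close> writes out everything below
    \<open>M\<close>.\<close>
  define M where "M = max (Suc n) (digit d 0)"
  obtain d' where d': "\<And>i. i < Suc M \<Longrightarrow> digit d' i = (case i of 0 \<Rightarrow> M | Suc i \<Rightarrow> mod_by y d i)"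
    using digit_ex[of "Suc M" "case_nat M (mod_by y d)"] by blast
  have "mod_by x d' i = mod_by y d i" for i
  proof (cases "i < M")
    case True
    then show ?thesis using d'[of 0] d'[of "Suc i"] by (simp add: mod_by_def)
  next
    case False
    then have "mod_by x d' i = x i" "mod_by y d i = y i" "n < i"
      using d'[of 0] by (auto simp: mod_by_def M_def)
    then show ?thesis using assms by simp
  qed
  then show ?thesis by blast
qed

text \<open>Two distinct equivalent points differ past \<open>node_len c\<close> and past the prefix
  replaced by \<open>d\<close>, so their modifications by \<open>d\<close> are different members of
  one class. Each would have strictly larger rank than the other, against
  \<open>simulated_linear\<close>.\<close>

lemma selected_discrete:
  assumes "node_len c \<le> l" "digit d 0 \<le> l"
  shows "pairwise (\<lambda>x y. \<not> E0 x y) (selected T c d l s)"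
proof (rule pairwiseI, rule notI)
  fix x y :: "nat \<Rightarrow> bool"
  let ?X = "\<lambda>k. of_bool (x k) :: nat" and ?Y = "\<lambda>k. of_bool (y k) :: nat"
  assume x: "x \<in> selected T c d l s" and y: "y \<in> selected T c d l s" and "x \<noteq> y" "E0 x y"
  then obtain n where n: "\<And>k. n < k \<Longrightarrow> x k = y k" by (auto simp: E0_def)
  obtain i where i: "x i \<noteq> y i" using \<open>x \<noteq> y\<close> by auto
  have "l \<le> i"
  proof (rule ccontr)
    assume "\<not> l \<le> i"
    then have "?X i = ?Y i" using x y by (simp add: selected_def)
    then show False using i by (cases "x i"; cases "y i") simp_all
  qed
  then have ne: "node_len c \<le> i" "mod_by ?X d i \<noteq> mod_by ?Y d i"
    using assms i by (cases "x i"; cases "y i"; simp add: mod_by_def)+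
  obtain dx where dx: "mod_by ?X dx = mod_by ?Y d" using mod_by_transfer[of n ?X ?Y d] n by auto
  obtain dy where dy: "mod_by ?Y dy = mod_by ?X d" using mod_by_transfer[of n ?Y ?X d] n by auto
  have "differ ?X c d dx" "differ ?Y c d dy" using ne by (auto simp: differ_def dx dy)
  then have "\<not> simulated (step T (mod_by ?X d)) (step T (mod_by ?X dx)) c c"
    "\<not> simulated (step T (mod_by ?Y d)) (step T (mod_by ?Y dy)) c c"
    using x y by (simp_all add: selected_def selects_def)
  then show False
    using simulated_linear[of "step T (mod_by ?X d)" "step T (mod_by ?Y d)" c c] unfolding dx dy by simp
qed

context closed_tree
begin

text \<open>The finite initial parts of \<open>X\<close> and its witness \<open>h\<close> form a
  chain of nodes of width 1 from an empty family member, so this starting node is realized by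
  \<open>X\<close> and hence covered. A minimal covered node then exists by
  well-foundedness.\<close>

lemma realized_minimal:
  assumes wf: "wfp (\<lambda>e c. child T c e)" and T: "\<forall>m. T X h m" and X: "\<And>i. X i < 2"
  shows "\<exists>c d. (\<forall>e. child T c e \<longrightarrow> \<not> covered T X e) \<and> selects T X d c"
proof -
  have "\<forall>n. \<exists>c. node_len c = n \<and> node_width c = 1 \<and> (\<forall>j<1. \<forall>i<n. node_str c j i = X i \<and> node_wit c j i = h i)"
    by (intro allI node_ex)
  from choice[OF this] obtain F where F: "\<forall>n. node_len (F n) = n \<and> node_width (F n) = 1 \<and>
      (\<forall>j<1. \<forall>i<n. node_str (F n) j i = X i \<and> node_wit (F n) j i = h i)" ..
  have "T (node_str (F n) 0) (node_wit (F n) 0) n = T X h n" for n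
    by (rule T_cong) (use F in simp_all)
  then have "good T (F n)" for n using F T X by (simp add: good_def)
  then have "step T X (F n) (F (Suc n))" for n using F by (simp add: step_def)
  then have has_chain: "has_chain (step T X) (F 0)" by (auto simp: has_chain_def chain_def)
  \<comment> \<open>A code with empty replaced prefix, which leaves \<open>X\<close>
    unchanged.\<close>
  obtain d0 where "digit d0 0 = 0" using digit_ex[of 1 "\<lambda>_. 0"] by auto
  then have "mod_by X d0 = X" by (auto simp: mod_by_def)
  then have "covered T X (F 0)" using has_chain_covered[OF wf, of X d0] has_chain by simp
  then show ?thesis by (rule minimal_covered[OF wf])
qed

lemma in_selected:
  assumes wf: "wfp (\<lambda>e c. child T c e)" and T: "\<forall>m. T (\<lambda>k. of_bool (x k)) h m"
  shows "\<exists>c d l s. node_len c \<le> l \<and> digit d 0 \<le> l \<and> x \<in> selected T c d l s"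
proof -
  define X where "X = (\<lambda>k. of_bool (x k) :: nat)"
  have "X i < 2" for i by (simp add: X_def)
  from realized_minimal[OF wf T[folded X_def] this]
  obtain c d where cd: "\<forall>e. child T c e \<longrightarrow> \<not> covered T X e" "selects T X d c" by blast
  define l where "l = max (node_len c) (digit d 0)"
  obtain s where "\<forall>i<l. digit s i = X i" using digit_ex by blast
  then have "x \<in> selected T c d l s" using cd by (simp add: selected_def X_def)
  moreover have "node_len c \<le> l" "digit d 0 \<le> l" by (simp_all add: l_def)
  ultimately show ?thesis by blast
qed

end

text \<open>The lower bound on the stem leaves room for replacing its first \<open>N\<close> digits
  in the final argument.\<close>

lemma E0_tree_in_Sigma11:
  assumes A: "Sigma11 z A" and x: "x \<in> A" "x \<in> H_set z"
  shows "\<exists>s v. (\<forall>k i. prefix [i] (v k i)) \<and> (\<forall>k. length (v k False) = length (v k True)) \<and>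
    N \<le> length s \<and> branches {t. \<exists>\<sigma>. prefix t (E0_node s v \<sigma>)} \<subseteq> A"
proof -
  have "\<exists>T. definable_tree T \<and> (\<forall>Z. closed_tree (T Z)) \<and>
    (\<forall>x. x \<in> A \<longleftrightarrow> (\<exists>h. \<forall>m. T (\<lambda>k. of_bool (z k)) (\<lambda>k. of_bool (x k)) h m))"
  proof (rule Sigma11_tree[OF A])
    fix T :: "(nat \<Rightarrow> nat) \<Rightarrow> (nat \<Rightarrow> nat) \<Rightarrow> (nat \<Rightarrow> nat) \<Rightarrow> nat \<Rightarrow> bool"
    assume Delta_pred_T: "\<And>a b c j. Delta_pred (\<lambda>G e. T (G a) (G b) (G c) (e j))"
      and T: "\<And>x. x \<in> A \<longleftrightarrow> (\<exists>h. \<forall>m. T (\<lambda>k. of_bool (z k)) (\<lambda>k. of_bool (x k)) h m)"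
      and cong: "\<And>Z X X' h h' m. (\<And>i. i < m \<Longrightarrow> X i = X' i) \<Longrightarrow> (\<And>i. i < m \<Longrightarrow> h i = h' i) \<Longrightarrow>
        T Z X h m = T Z X' h' m"
      and mono: "\<And>Z X h m m'. m \<le> m' \<Longrightarrow> T Z X h m' \<Longrightarrow> T Z X h m"
    have "definable_tree T" by unfold_locales (rule Delta_pred_T)
    moreover have "closed_tree (T Z)" for Z
    proof
      show "T Z X h m = T Z X' h' m"
        if "\<And>i. i < m \<Longrightarrow> X i = X' i" "\<And>i. i < m \<Longrightarrow> h i = h' i" for X X' h h' m
        using that by (rule cong)
      show "T Z X h m" if "m \<le> m'" "T Z X h m'" for X h m m'
        using that by (rule mono)
    qed
    ultimately show ?thesis using T by blast
  qed
  then obtain T where def_T: "definable_tree T" and closed_all: "\<forall>Z. closed_tree (T Z)"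
    and T: "\<And>x. x \<in> A \<longleftrightarrow> (\<exists>h. \<forall>m. T (\<lambda>k. of_bool (z k)) (\<lambda>k. of_bool (x k)) h m)"
    by auto
  let ?T = "T (\<lambda>k. of_bool (z k))" and ?X = "\<lambda>k. of_bool (x k) :: nat"
  have closed: "closed_tree ?T" using closed_all by blast
  interpret closed_tree ?T by (rule closed)
  have not_wf: "\<not> wfp (\<lambda>e c. child ?T c e)"
  proof
    assume wf: "wfp (\<lambda>e c. child ?T c e)"
    obtain h where h: "\<forall>m. ?T ?X h m" using x(1) unfolding T ..
    obtain c d l s where l: "node_len c \<le> l" "digit d 0 \<le> l" and xs: "x \<in> selected ?T c d l s"
      using in_selected[OF wf h] by (elim exE conjE)
    have "Delta11 z (selected ?T c d l s)"
      by (rule selected_Delta11[OF def_T closed wf])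
    moreover have "pairwise (\<lambda>x y. \<not> E0 x y) (selected ?T c d l s)"
      by (rule selected_discrete[OF l])
    ultimately have "x \<in> S_set z" unfolding S_set_def using xs by blast
    then show False using x(2) by (simp add: H_set_def)
  qed
  from not_wfp_chain[OF this] obtain f where f: "chain (child ?T) f" ..
  have len_f: "n \<le> node_len (f n)" for n
  proof (induction n)
    case (Suc n)
    have "child ?T (f n) (f (Suc n))" using f by (simp add: chain_def)
    then have "node_len (f n) < node_len (f (Suc n))" by (auto simp: child_def)
    then show ?case using Suc by simp
  qed simp
  show ?thesis
  \<comment> \<open>The chain is entered at \<open>N + 1\<close>: lengths grow strictly, so that
    node is long enough, and as a child of \<open>f N\<close> it is good.\<close>
  proof (rule tree_of_chain[where c = "\<lambda>n. f (n + Suc N)"])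
    show "chain (child ?T) (\<lambda>n. f (n + Suc N))" using f by (simp add: chain_def)
    have "child ?T (f N) (f (Suc N))" using f by (simp add: chain_def)
    then show "good ?T (f (0 + Suc N))" by (simp add: child_def)
    fix s :: "bool list" and v :: "nat \<Rightarrow> bool \<Rightarrow> bool list"
    assume v: "\<And>k i. prefix [i] (v k i)" "\<And>k. length (v k False) = length (v k True)"
      and s: "node_len (f (0 + Suc N)) \<le> length s"
      and b: "\<And>x. x \<in> branches {t. \<exists>\<sigma>. prefix t (E0_node s v \<sigma>)} \<Longrightarrow> \<exists>h. \<forall>m. ?T (\<lambda>k. of_bool (x k)) h m"
    show ?thesis
    proof (rule exI[of _ s], rule exI[of _ v], intro conjI allI)
      show "N \<le> length s" using len_f[of "Suc N"] s by simp
      show "branches {t. \<exists>\<sigma>. prefix t (E0_node s v \<sigma>)} \<subseteq> A"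
        by (rule subsetI, unfold T, rule b)
    qed (rule v)+
  qed
qed

section \<open>Exchange of stems\<close>

lemma E0_node_stem: "E0_node s v \<sigma> = s @ E0_node [] v \<sigma>"
  by (simp add: E0_node_def)

lemma prefix_map_upt: "prefix (map x [0..<m]) l \<longleftrightarrow> m \<le> length l \<and> (\<forall>i<m. l ! i = x i)"
proof -
  have "prefix (map x [0..<m]) l \<longleftrightarrow> m \<le> length l \<and> take m l = map x [0..<m]"
    by (metis append_take_drop_id length_map length_upt minus_nat.diff_0 prefix_def prefix_length_le append_eq_conv_conj)
  also have "\<dots> \<longleftrightarrow> m \<le> length l \<and> (\<forall>i<m. l ! i = x i)"
    by (auto simp: list_eq_iff_nth_eq)
  finally show ?thesis .
qed

theorem theorem5p14:
  fixes z :: "nat \<Rightarrow> bool" and n :: nat and A :: "nat \<Rightarrow> (nat \<Rightarrow> bool) set"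
  assumes "\<And>a. a < n \<Longrightarrow> Sigma11 z (A a)"
    and "(\<Inter>a<n. E0_saturation (A a \<inter> H_set z)) \<noteq> {}"
  shows "\<exists>(p :: nat \<Rightarrow> bool list set) (s :: nat \<Rightarrow> bool list) (v :: nat \<Rightarrow> nat \<Rightarrow> bool \<Rightarrow> bool list).
    (\<forall>a<n. E0_tree (p a) (s a) (v a)) \<and>
    (\<forall>a<n. \<forall>b<n. length (s a) = length (s b) \<and> (\<forall>k i. v a k i = v b k i)) \<and>
    (\<forall>a<n. branches (p a) \<subseteq> A a)"
proof (cases "n = 0")
  case False
  obtain y where "\<And>a. a < n \<Longrightarrow> \<exists>x \<in> A a \<inter> H_set z. E0 x y"
    using assms(2) by (auto simp: E0_saturation_def)
  then have "\<forall>a. \<exists>x m. a < n \<longrightarrow> x \<in> A a \<and> x \<in> H_set z \<and> (\<forall>k>m. x k = y k)"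
    unfolding E0_def by blast
  from choice[OF this] obtain x where "\<forall>a. \<exists>m. a < n \<longrightarrow> x a \<in> A a \<and> x a \<in> H_set z \<and> (\<forall>k>m. x a k = y k)" ..
  from choice[OF this] obtain m
    where x: "\<And>a. a < n \<Longrightarrow> x a \<in> A a \<and> x a \<in> H_set z \<and> (\<forall>k>m a. x a k = y k)" by blast
  \<comment> \<open>\<open>N\<close> exceeds every \<open>m a\<close>, so all the points
    \<open>x a\<close> agree with \<open>y\<close> from position \<open>N\<close> on.\<close>
  define N where "N = Suc (\<Sum>a<n. m a)"
  have N: "x a k = y k" if "a < n" "N \<le> k" for a k
    using x[OF that(1)] member_le_sum[of a "{..<n}" m] that by (auto simp: N_def)
  define graft where "graft a u = (\<lambda>k. if k < N then x a k else u k)" for a u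
  define A' where "A' = {u. \<forall>a<n. u \<in> {u. graft a u \<in> A a}}"
  have "Sigma11 z A'"
    unfolding A'_def graft_def by (intro Sigma11_INT Sigma11_graft assms(1))
  \<comment> \<open>Since the points \<open>x a\<close> differ only below \<open>N\<close>, grafting
    their stems onto \<open>x 0\<close> recovers all of them; thus \<open>x 0\<close> alone
    witnesses that \<open>A'\<close> meets \<open>H_set z\<close>.\<close>
  moreover have "graft a (x 0) = x a" if "a < n" for a
    using N[OF that] N[of 0] False by (auto simp: graft_def fun_eq_iff)
  then have "x 0 \<in> A'" using x by (simp add: A'_def)
  moreover have "x 0 \<in> H_set z" using x False by blast
  ultimately have "\<exists>s v. (\<forall>k i. prefix [i] (v k i)) \<and> (\<forall>k. length (v k False) = length (v k True)) \<and>
    N \<le> length s \<and> branches {t. \<exists>\<sigma>. prefix t (E0_node s v \<sigma>)} \<subseteq> A'"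
    by (rule E0_tree_in_Sigma11)
  then obtain s v where v: "\<forall>k i. prefix [i] (v k i)" "\<forall>k. length (v k False) = length (v k True)"
    and s: "N \<le> length s" and sub: "branches {t. \<exists>\<sigma>. prefix t (E0_node s v \<sigma>)} \<subseteq> A'"
    by (elim exE conjE)
  \<comment> \<open>Only the first \<open>N\<close> digits of the stem are exchanged, so all stems
    have the length of \<open>s\<close> and the strings \<open>v\<close> are common to all
    trees.\<close>
  define S where "S a = map (x a) [0..<N] @ drop N s" for a
  define p where "p a = {t. \<exists>\<sigma>. prefix t (E0_node (S a) v \<sigma>)}" for a
  have len_S: "length (S a) = length s" for a using s by (simp add: S_def)
  have nth_S: "E0_node (S a) v \<sigma> ! i = (if i < N then x a i else E0_node s v \<sigma> ! i)" for a \<sigma> i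
    using s by (auto simp: E0_node_stem[of "S a"] E0_node_stem[of s] nth_append len_S)
      (auto simp: S_def nth_append)
  have "branches (p a) \<subseteq> A a" if a: "a < n" for a
  proof
    fix u assume u: "u \<in> branches (p a)"
    have ex: "\<exists>\<sigma>. m \<le> length (E0_node s v \<sigma>) \<and> (\<forall>i<m. E0_node (S a) v \<sigma> ! i = u i)" for m
    proof -
      have "length (E0_node (S a) v \<sigma>) = length (E0_node s v \<sigma>)" for \<sigma>
        by (simp add: E0_node_stem[of "S a"] E0_node_stem[of s] len_S)
      then show ?thesis using u by (simp add: branches_def p_def prefix_map_upt)
    qed
    \<comment> \<open>Undoing the exchange turns the branch \<open>u\<close> into a branch of the
      tree inside \<open>A'\<close>; grafting the stem of \<open>x a\<close> onto it gives
      \<open>u\<close> back.\<close>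
    define u' where "u' k = (if k < N then s ! k else u k)" for k
    have "u' \<in> branches {t. \<exists>\<sigma>. prefix t (E0_node s v \<sigma>)}"
      unfolding branches_def mem_Collect_eq prefix_map_upt
    proof
      fix m
      obtain \<sigma> where \<sigma>: "m \<le> length (E0_node s v \<sigma>)" "\<And>i. i < m \<Longrightarrow> E0_node (S a) v \<sigma> ! i = u i"
        using ex by blast
      have "E0_node s v \<sigma> ! i = u' i" if "i < m" for i
        using \<sigma>(2)[OF that] nth_S[of a \<sigma> i] s
        by (auto simp: u'_def E0_node_stem[of s] nth_append)
      then show "\<exists>\<sigma>. m \<le> length (E0_node s v \<sigma>) \<and> (\<forall>i<m. E0_node s v \<sigma> ! i = u' i)"
        using \<sigma>(1) by blast
    qed
    then have "graft a u' \<in> A a" using sub a by (auto simp: A'_def)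
    moreover have "graft a u' = u"
    proof
      fix k
      obtain \<sigma> where "E0_node (S a) v \<sigma> ! k = u k" using ex[of "Suc k"] by blast
      then show "graft a u' k = u k" by (cases "k < N") (simp_all add: nth_S graft_def u'_def)
    qed
    ultimately show "u \<in> A a" by simp
  qed
  then show ?thesis
    using v len_S by (intro exI[of _ p] exI[of _ S] exI[of _ "\<lambda>_. v"]) (simp add: E0_tree_def p_def)
qed simp

end
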